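(* Let $\beta>0$, $M>0$, $G(s)=\exp(-\beta s)$, and $\varrho_0:=M/|\mathbb T^d|$. For real-valued smooth $\eta$ on $\mathbb T^d$ with $\int_{\mathbb T^d}\eta\,\mathrm dx=0$, the second variation of $\mathcal F_\beta$ at $\varrho_0$ is $$\delta^2\mathcal F_\beta(\varrho_0)[\eta,\eta]=\int_{\mathbb T^d}\frac{\eta^2}{\varrho_0}\,\mathrm dx-2\beta\int_{\mathbb T^d}\eta\,(W\ast\eta)\,\mathrm dx=\sum_{n\in\mathbb Z^d\setminus\{0\}}\left(\frac1{\varrho_0}-2\beta\widehat W_n\right)|\widehat\eta_n|^2 .$$ Consequently, for each $n\in\mathbb Z^d\setminus\{0\}$, the homogeneous state $\varrho_0$ loses local minimality in the mode $n$ (i.e. $\delta^2\mathcal F_\beta(\varrho_0)[\eta,\eta]<0$ for nonzero real $\eta$ in the span of $\cos(2\pi n\cdot x),\sin(2\pi n\cdot x)$) if and only if $$\widehat W_n>\frac1{2\beta\varrho_0},$$ and this holds if and only if the mode $n$ is linearly unstable for the equation $\partial_t\varrho=\frac12\Delta\bigl(G(W\ast\varrho)^2\varrho\bigr)$ linearized at $\varrho_0$.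
   Context: $\mathbb T^d=\mathbb R^d/\mathbb Z^d$. The kernel $W:\mathbb T^d\to[0,\infty)$ is bounded, radially symmetric (in particular even), nonincreasing with respect to $|x|$, obtained by periodic extension of a compactly supported function on $\mathbb R^d$, and normalized by $\int_{\mathbb T^d}W\,\mathrm dx=1$. Fourier coefficients: $\widehat h_n=\int_{\mathbb T^d}h(x)e^{-2\pi i n\cdot x}\,\mathrm dx$; the $\widehat W_n$ are real. $W\ast\varrho$ is the periodic convolution. The free energy is $$\mathcal F_\beta(\varrho)=\int_{\mathbb T^d}\varrho(\log\varrho-1)\,\mathrm dx-\beta\int_{\mathbb T^d}\varrho\,(W\ast\varrho)\,\mathrm dx ,$$ and $\delta^2\mathcal F_\beta(\varrho_0)[\eta,\eta]=\frac{\mathrm d^2}{\mathrm d\varepsilon^2}\mathcal F_\beta(\varrho_0+\varepsilon\eta)\big|_{\varepsilon=0}$. The linearization at $\varrho_0$ in Fourier variables reads $$\frac{\mathrm d}{\mathrm dt}\widehat\varrho_n+|2\pi n|^2\,\frac{G(\varrho_0)}2\bigl(G(\varrho_0)+2G'(\varrho_0)\varrho_0\widehat W_n\bigr)\widehat\varrho_n=0,$$ and the mode $n\ne0$ is called linearly unstable if its solutions grow, i.e. if $G(\varrho_0)+2G'(\varrho_0)\varrho_0\widehat W_n<0$. *)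

theory Defs
  imports "HOL-Analysis.Analysis"
begin

text \<open>Functions on the torus \<open>\<real>\<^sup>d/\<int>\<^sup>d\<close> are represented by \<open>\<int>\<^sup>d\<close>-periodic functions
  on \<open>real ^ 'd\<close>, and integrals over the torus by integrals over the centred unit cell.\<close>

definition real_vec :: "int ^ 'd \<Rightarrow> real ^ 'd" where
  "real_vec k = (\<chi> i. real_of_int (k $ i))"

definition periodic :: "(real ^ 'd \<Rightarrow> 'b) \<Rightarrow> bool" where
  "periodic f \<longleftrightarrow> (\<forall>x k. f (x + real_vec k) = f x)"

definition torus_cell :: "(real ^ 'd) set" where
  "torus_cell = cbox (\<chi> i. - (1/2)) (\<chi> i. 1/2)"

definition torus_integral :: "(real ^ 'd \<Rightarrow> 'b) \<Rightarrow> 'b::{banach, second_countable_topology}" where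
  "torus_integral f = (LINT x:torus_cell|lborel. f x)"

definition torus_volume :: "'d::finite itself \<Rightarrow> real" where
  "torus_volume _ = measure lborel (torus_cell :: (real ^ 'd) set)"

definition torus_conv :: "(real ^ 'd \<Rightarrow> real) \<Rightarrow> (real ^ 'd \<Rightarrow> real) \<Rightarrow> real ^ 'd \<Rightarrow> real" where
  "torus_conv W \<rho> x = torus_integral (\<lambda>y. W (x - y) * \<rho> y)"

definition fourier_coeff :: "(real ^ 'd \<Rightarrow> real) \<Rightarrow> int ^ 'd \<Rightarrow> complex" where
  "fourier_coeff h n =
     torus_integral (\<lambda>x. of_real (h x) * exp (- 2 * of_real pi * \<i> * of_real (real_vec n \<bullet> x)))"

text \<open>On the centred cell the Euclidean norm of a representative is the distance to \<open>0\<close>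
  on the torus. Opposite points of the boundary of the cell have the same norm, so a radial
  profile \<open>w\<close> has a well-defined periodic extension from the closed cell.\<close>

definition periodic_extension :: "(real ^ 'd \<Rightarrow> 'b) \<Rightarrow> (real ^ 'd \<Rightarrow> 'b) \<Rightarrow> bool" where
  "periodic_extension W w \<longleftrightarrow> (\<forall>x \<in> torus_cell. \<forall>k. W (x + real_vec k) = w x)"

definition interaction_kernel :: "(real ^ 'd \<Rightarrow> real) \<Rightarrow> bool" where
  "interaction_kernel W \<longleftrightarrow>
     (\<forall>x. 0 \<le> W x) \<and> bounded (range W) \<and>
     (\<exists>w. (\<exists>K. compact K \<and> (\<forall>x. x \<notin> K \<longrightarrow> w x = 0)) \<and>
          (\<forall>x y. norm x = norm y \<longrightarrow> w x = w y) \<and>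
          (\<forall>x y. norm x \<le> norm y \<longrightarrow> w y \<le> w x) \<and>
          periodic_extension W w) \<and>
     torus_integral W = 1"

fun C_k :: "nat \<Rightarrow> (real ^ 'd \<Rightarrow> real) \<Rightarrow> bool" where
  "C_k 0 f \<longleftrightarrow> continuous_on UNIV f"
| "C_k (Suc k) f \<longleftrightarrow>
     (\<forall>x. f differentiable (at x)) \<and> (\<forall>v. C_k k (\<lambda>x. frechet_derivative f (at x) v))"

definition torus_smooth :: "(real ^ 'd \<Rightarrow> real) \<Rightarrow> bool" where
  "torus_smooth f \<longleftrightarrow> periodic f \<and> (\<forall>k. C_k k f)"

definition free_energy ::
    "real \<Rightarrow> (real ^ 'd \<Rightarrow> real) \<Rightarrow> (real ^ 'd \<Rightarrow> real) \<Rightarrow> real" where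
  "free_energy \<beta> W \<rho> =
     torus_integral (\<lambda>x. \<rho> x * (ln (\<rho> x) - 1)) - \<beta> * torus_integral (\<lambda>x. \<rho> x * torus_conv W \<rho> x)"

definition second_variation ::
    "((real ^ 'd \<Rightarrow> real) \<Rightarrow> real) \<Rightarrow> real \<Rightarrow> (real ^ 'd \<Rightarrow> real) \<Rightarrow> real" where
  "second_variation F \<rho>\<^sub>0 \<eta> = (deriv ^^ 2) (\<lambda>\<epsilon>. F (\<lambda>x. \<rho>\<^sub>0 + \<epsilon> * \<eta> x)) 0"

definition mode_space :: "int ^ 'd \<Rightarrow> (real ^ 'd \<Rightarrow> real) set" where
  "mode_space n =
     {\<lambda>x. a * cos (2 * pi * (real_vec n \<bullet> x)) + b * sin (2 * pi * (real_vec n \<bullet> x)) | a b. True}"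

definition loses_local_minimality ::
    "((real ^ 'd \<Rightarrow> real) \<Rightarrow> real) \<Rightarrow> real \<Rightarrow> int ^ 'd \<Rightarrow> bool" where
  "loses_local_minimality F \<rho>\<^sub>0 n \<longleftrightarrow>
     (\<forall>\<eta> \<in> mode_space n. \<eta> \<noteq> (\<lambda>x. 0) \<longrightarrow> second_variation F \<rho>\<^sub>0 \<eta> < 0)"

definition laplacian :: "(real ^ 'd \<Rightarrow> real) \<Rightarrow> real ^ 'd \<Rightarrow> real" where
  "laplacian f x = (\<Sum>i\<in>UNIV. (deriv ^^ 2) (\<lambda>s. f (x + s *\<^sub>R axis i 1)) 0)"

text \<open>The right-hand side of \<open>\<partial>\<^sub>t \<rho> = 1/2 \<Delta> (G(W * \<rho>)\<^sup>2 \<rho>)\<close> and its linearization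
  at the constant state \<open>\<rho>\<^sub>0\<close>.\<close>

definition evolution_rhs ::
    "(real \<Rightarrow> real) \<Rightarrow> (real ^ 'd \<Rightarrow> real) \<Rightarrow> (real ^ 'd \<Rightarrow> real) \<Rightarrow> real ^ 'd \<Rightarrow> real" where
  "evolution_rhs G W \<rho> x = 1/2 * laplacian (\<lambda>y. (G (torus_conv W \<rho> y))\<^sup>2 * \<rho> y) x"

definition linearized_rhs ::
    "(real \<Rightarrow> real) \<Rightarrow> (real ^ 'd \<Rightarrow> real) \<Rightarrow> real \<Rightarrow> (real ^ 'd \<Rightarrow> real) \<Rightarrow> real ^ 'd \<Rightarrow> real" where
  "linearized_rhs G W \<rho>\<^sub>0 \<eta> x = deriv (\<lambda>\<epsilon>. evolution_rhs G W (\<lambda>y. \<rho>\<^sub>0 + \<epsilon> * \<eta> y) x) 0"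

definition linearized_mode_solution ::
    "(real \<Rightarrow> real) \<Rightarrow> (real ^ 'd \<Rightarrow> real) \<Rightarrow> real \<Rightarrow> int ^ 'd \<Rightarrow> (real \<Rightarrow> real ^ 'd \<Rightarrow> real) \<Rightarrow> bool"
  where
  "linearized_mode_solution G W \<rho>\<^sub>0 n \<eta> \<longleftrightarrow>
     (\<forall>t\<ge>0. \<eta> t \<in> mode_space n) \<and>
     (\<forall>t\<ge>0. \<forall>x. ((\<lambda>s. \<eta> s x) has_real_derivative linearized_rhs G W \<rho>\<^sub>0 (\<eta> t) x)
                  (at t within {0..}))"

text \<open>In Fourier variables the equation for a mode is a scalar linear ODE with constant
  coefficients, so its nonzero solutions either all grow or none does.\<close>

definition linearly_unstable ::
    "(real \<Rightarrow> real) \<Rightarrow> (real ^ 'd \<Rightarrow> real) \<Rightarrow> real \<Rightarrow> int ^ 'd \<Rightarrow> bool" where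
  "linearly_unstable G W \<rho>\<^sub>0 n \<longleftrightarrow>
     (\<forall>\<eta>. linearized_mode_solution G W \<rho>\<^sub>0 n \<eta> \<and> \<eta> 0 \<noteq> (\<lambda>x. 0) \<longrightarrow>
          filterlim (\<lambda>t. norm (fourier_coeff (\<eta> t) n)) at_top at_top)"

text \<open>The Fourier coefficients of the kernel are real, so no information is lost when
  \<open>Re (fourier_coeff W n)\<close> is used for \<open>\<widehat>W\<^sub>n\<close>.\<close>

lemma fourier_coeff_kernel_real:
  fixes W :: "real ^ 'd \<Rightarrow> real"
  assumes "interaction_kernel W"
  shows "fourier_coeff W n \<in> \<real>"
proof -
  let ?f = "\<lambda>x. of_real (W x) * exp (- 2 * of_real pi * \<i> * of_real (real_vec n \<bullet> x)) :: complex"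
  obtain w where w: "\<And>x y. norm x = norm y \<Longrightarrow> w x = w y" and ext: "periodic_extension W w"
    using assms unfolding interaction_kernel_def by blast
  have Ww: "W x = w x" if "x \<in> torus_cell" for x
  proof -
    have "real_vec 0 = (0 :: real ^ 'd)" by (simp add: real_vec_def vec_eq_iff)
    then show ?thesis using ext that unfolding periodic_extension_def by (metis add.right_neutral)
  qed
  have neg: "- x \<in> torus_cell" if "x \<in> torus_cell" for x :: "real ^ 'd"
    using that unfolding torus_cell_def mem_box_cart by (auto simp: minus_le_iff le_minus_iff)
  have even: "W (- x) = W x" if "x \<in> torus_cell" for x
    using Ww[OF that] Ww[OF neg[OF that]] w[of x "- x"] by simp
  have "(LINT x:torus_cell|lborel. W x) = 1"
    using assms unfolding interaction_kernel_def torus_integral_def by simp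
  then have intW: "set_integrable lborel torus_cell W"
    unfolding set_integrable_def set_lebesgue_integral_def
    by (metis not_integrable_integral_eq zero_neq_one)
  have "set_integrable lborel torus_cell ?f"
  proof -
    have "integrable lborel (\<lambda>x. exp (- 2 * of_real pi * \<i> * of_real (real_vec n \<bullet> x)) *
            of_real (indicator torus_cell x *\<^sub>R W x) :: complex)"
    proof (rule Bochner_Integration.integrable_bound[OF intW[unfolded set_integrable_def]])
      have "(\<lambda>x. indicator torus_cell x *\<^sub>R W x) \<in> borel_measurable lborel"
        using intW unfolding set_integrable_def by (rule borel_measurable_integrable)
      then have "(\<lambda>x. of_real (indicator torus_cell x *\<^sub>R W x) :: complex)
          \<in> borel_measurable lborel"
        by (rule measurable_compose[OF _ borel_measurable_of_real])
      moreover have "(\<lambda>x. exp (- 2 * of_real pi * \<i> * of_real (real_vec n \<bullet> x)) :: complex)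
          \<in> borel_measurable lborel"
        unfolding measurable_lborel2
        by (intro borel_measurable_continuous_onI continuous_intros)
      ultimately show "(\<lambda>x. exp (- 2 * of_real pi * \<i> * of_real (real_vec n \<bullet> x)) *
            of_real (indicator torus_cell x *\<^sub>R W x) :: complex) \<in> borel_measurable lborel"
        by (rule borel_measurable_times[rotated])
    qed (auto simp: norm_mult norm_exp_eq_Re)
    then show ?thesis
      unfolding set_integrable_def by (simp add: scaleR_conv_of_real mult_ac)
  qed
  then have hk: "(?f has_integral fourier_coeff W n) torus_cell"
    using integrable_integral[OF set_borel_integral_eq_integral(1)]
    unfolding fourier_coeff_def torus_integral_def
    by (simp only: set_borel_integral_eq_integral(2))
  have cell: "torus_cell = cbox (- (\<chi> i. 1/2)) (- (\<chi> i. - (1/2)) :: real ^ 'd)"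
    unfolding torus_cell_def by (simp add: set_eq_iff mem_box_cart)
  have "((\<lambda>x. ?f (- x)) has_integral fourier_coeff W n) torus_cell"
    unfolding cell using hk[unfolded torus_cell_def] by (rule iffD2[OF has_integral_reflect])
  moreover have "?f (- x) = cnj (?f x)" if "x \<in> torus_cell" for x
    using even[OF that] by (simp add: exp_cnj)
  ultimately have "((\<lambda>x. cnj (?f x)) has_integral fourier_coeff W n) torus_cell"
    by (rule has_integral_eq[rotated]) auto
  moreover have "((\<lambda>x. cnj (?f x)) has_integral cnj (fourier_coeff W n)) torus_cell"
    using has_integral_linear[OF hk bounded_linear_cnj] by (simp add: o_def)
  ultimately have "cnj (fourier_coeff W n) = fourier_coeff W n"
    by (rule has_integral_unique[symmetric])
  then show ?thesis by (simp add: Reals_cnj_iff)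
qed

end

(* The Fourier side of the second variation is Parseval's identity, obtained here for continuous
   periodic functions from the best-approximation property of partial Fourier sums together with
   the uniform density of trigonometric polynomials (Stone-Weierstrass on the image of the torus
   in complex ^ 'd).  Polarising it with W * eta, whose coefficients are products by Fubini, gives
   the interaction term.  On the span of cos and sin in the mode n both quadratic form and
   linearized operator act by scalars, and the two scalars have the same sign condition. *)

theory Submission
  imports Defs
begin

section \<open>Translation invariance of torus integrals\<close>

text \<open>The kernel is only bounded and may jump, so Parseval is never applied to
  \<open>W\<close> itself but to \<open>\<eta>\<close> and to the sum and difference of
  \<open>\<eta>\<close> and \<open>torus_conv W \<eta>\<close>. That convolution is continuous
  because a change of variables moves the translation from the kernel onto \<open>\<eta>\<close>;
  hence the need for translation invariance of an integral that is defined over one fixed cell. In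
  the coefficient 1/rho0 - 2 beta What_n, the first term is the second derivative of the entropy
  density u (ln u - 1), and the second comes from an interaction energy that is exactly quadratic
  along rho0 + t eta, since convolution with a kernel of mass one fixes constants. The mean-zero
  condition removes n = 0 from the sum. The growth rate of mode n is -rho0 |2 pi n|^2 G(rho0)^2 / 2
  times that same coefficient; the prefactor is negative for n nonzero, which is why loss of
  minimality and growth coincide.\<close>

definition torus_measure :: "(real ^ 'd::finite) measure" where
  "torus_measure = restrict_space lborel torus_cell"

text \<open>Trades the set integral for an integral against a finite measure of mass one, the
  setting of Fubini, dominated convergence and integrability of bounded functions.\<close>

lemma torus_integral_eq: "torus_integral f = integral\<^sup>L torus_measure f"
  unfolding torus_integral_def torus_measure_def set_lebesgue_integral_def
  by (subst integral_restrict_space) (auto simp: torus_cell_def)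

lemma emeasure_torus_cell:
  "emeasure lborel (torus_cell :: (real ^ 'd::finite) set) = 1"
  "emeasure lborel (box (\<chi> i. - (1/2)) (\<chi> i. 1/2) :: (real ^ 'd) set) = 1"
proof -
  have *: "((\<chi> i. 1/2) - (\<chi> i. - (1/2))) \<bullet> b = 1" "(\<chi> i. - (1/2)) \<bullet> b \<le> (\<chi> i. 1/2) \<bullet> b"
    if "b \<in> Basis" for b :: "real ^ 'd"
    using that by (auto simp: Basis_vec_def inner_axis)
  show "emeasure lborel (torus_cell :: (real ^ 'd) set) = 1"
    unfolding torus_cell_def using *(2) by (subst emeasure_lborel_cbox) (simp_all add: * del: inner_diff_left)
  show "emeasure lborel (box (\<chi> i. - (1/2)) (\<chi> i. 1/2) :: (real ^ 'd) set) = 1"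
    using *(2) by (subst emeasure_lborel_box) (simp_all add: * del: inner_diff_left)
qed

lemma torus_volume_eq_1: "torus_volume TYPE('d::finite) = 1"
  by (simp add: torus_volume_def measure_def emeasure_torus_cell)

interpretation torus: finite_measure "torus_measure :: (real ^ 'd::finite) measure"
  by (rule finite_measureI)
    (simp add: torus_measure_def emeasure_restrict_space space_restrict_space torus_cell_def
      emeasure_torus_cell[unfolded torus_cell_def])

lemma measure_torus_space: "measure torus_measure (space torus_measure :: (real ^ 'd::finite) set) = 1"
  using torus_volume_eq_1[where 'd='d]
  by (simp add: torus_measure_def measure_restrict_space space_restrict_space torus_cell_def torus_volume_def)

lemma measurable_torus_measure:
  "f \<in> borel_measurable borel \<Longrightarrow> f \<in> borel_measurable torus_measure"
  unfolding torus_measure_def by (rule measurable_restrict_space1) simp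

text \<open>The lattice vector whose subtraction moves \<open>x\<close> into the half-open cell with
  sides [-1/2, 1/2). Half-open sides make it unique, so the translated cells partition the space,
  which closed cells do not.\<close>

definition cell_index :: "real ^ 'd \<Rightarrow> int ^ 'd::finite" where
  "cell_index x = (\<chi> i. \<lfloor>x $ i + 1/2\<rfloor>)"

lemma real_vec_simps [simp]:
  "real_vec 0 = 0" "real_vec (k + l) = real_vec k + real_vec l" "real_vec (- k) = - real_vec k"
  "real_vec (k - l) = real_vec k - real_vec l" "real_vec k $ i = real_of_int (k $ i)"
  by (simp_all add: real_vec_def vec_eq_iff)

lemma cell_index_shift: "cell_index (x + real_vec k) = cell_index x + k"
  unfolding cell_index_def vec_eq_iff
proof
  fix i
  have "x $ i + real_of_int (k $ i) + 1/2 = x $ i + 1/2 + real_of_int (k $ i)" by simp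
  then show "(\<chi> i. \<lfloor>(x + real_vec k) $ i + 1/2\<rfloor>) $ i = ((\<chi> i. \<lfloor>x $ i + 1/2\<rfloor>) + k) $ i"
    by (simp only: vec_lambda_beta vector_add_component real_vec_simps floor_add_int)
qed

lemma sets_cell_index: "{x. cell_index (x - a) = k} \<in> sets borel"
proof -
  have "{x. cell_index (x - a) = k} = (\<Inter>i. {x. of_int (k $ i) \<le> x $ i - a $ i + 1/2 \<and> x $ i - a $ i + 1/2 < of_int (k $ i) + 1})"
    by (auto simp: cell_index_def vec_eq_iff floor_eq_iff)
  moreover have "\<dots> \<in> sets borel"
    by (intro sets.finite_INT) auto
  ultimately show ?thesis by simp
qed

text \<open>The closed and the half-open cell both lie between the open box and its closure, and
  these two have the same volume 1.\<close>

lemma AE_cell_index: "AE x in lborel. x \<in> torus_cell \<longleftrightarrow> cell_index x = 0"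
proof (rule AE_I)
  let ?b = "box (\<chi> i. - (1/2)) (\<chi> i. 1/2) :: (real ^ 'd) set"
  show "emeasure lborel (torus_cell - ?b) = 0"
    by (subst emeasure_Diff)
      (auto simp: emeasure_torus_cell torus_cell_def emeasure_torus_cell[unfolded torus_cell_def] mem_box_cart less_imp_le)
  have idx: "cell_index x = 0 \<longleftrightarrow> (\<forall>i. - (1/2) \<le> x $ i \<and> x $ i < 1/2)" for x :: "real ^ 'd"
  proof -
    have "\<lfloor>t + 1/2\<rfloor> = 0 \<longleftrightarrow> - (1/2) \<le> t \<and> t < 1/2" for t :: real
      by (simp only: floor_eq_iff) (auto simp: field_simps)
    then show ?thesis by (simp add: cell_index_def vec_eq_iff)
  qed
  show "{x \<in> space lborel. \<not> (x \<in> torus_cell \<longleftrightarrow> cell_index x = 0)} \<subseteq> torus_cell - ?b"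
  proof
    fix x :: "real ^ 'd"
    assume "x \<in> {x \<in> space lborel. \<not> (x \<in> torus_cell \<longleftrightarrow> cell_index x = 0)}"
    then have "\<not> (x \<in> torus_cell \<longleftrightarrow> cell_index x = 0)" by simp
    moreover have "cell_index x = 0 \<Longrightarrow> x \<in> torus_cell" "x \<in> ?b \<Longrightarrow> cell_index x = 0"
      by (auto simp: idx torus_cell_def mem_box_cart less_imp_le)
    ultimately show "x \<in> torus_cell - ?b" by blast
  qed
qed (simp add: torus_cell_def)

lemma emeasure_torus_shift:
  fixes B :: "(real ^ 'd::finite) set"
  assumes B: "B \<in> sets borel" and per: "\<And>x k. x + real_vec k \<in> B \<longleftrightarrow> x \<in> B"
  shows "emeasure lborel {x. cell_index x = 0 \<and> x + a \<in> B} = emeasure lborel {x. cell_index x = 0 \<and> x \<in> B}"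
proof -
  have M1: "{x. cell_index x = k} \<in> sets borel" for k :: "int ^ 'd"
    by (rule sets_cell_index[of 0, unfolded diff_zero])
  have M2: "{x. cell_index (x - a) = k} \<in> sets borel" for k :: "int ^ 'd"
    by (rule sets_cell_index)
  have translate: "emeasure lborel {x. c + x \<in> A} = emeasure lborel A" if "A \<in> sets borel" for A and c :: "real ^ 'd"
    using that arg_cong[OF lborel_distr_plus[of c], of "\<lambda>M. emeasure M A"]
    by (simp add: emeasure_distr vimage_def)
  \<comment> \<open>Cut the shifted cell along the lattice cells; translating the \<open>k\<close>-th piece \<open>S k\<close> by \<open>-k\<close>
    gives \<open>S' k\<close>, and the \<open>S' k\<close> tile the original cell.\<close>
  define S where "S k = {x \<in> B. cell_index (x - a) = 0 \<and> cell_index x = k}" for k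
  define S' where "S' k = {x \<in> B. cell_index (x - a) = - k \<and> cell_index x = 0}" for k
  have S_eq: "S k = B \<inter> {x. cell_index (x - a) = 0} \<inter> {x. cell_index x = k}" for k
    by (auto simp: S_def)
  have S'_eq: "S' k = B \<inter> {x. cell_index (x - a) = - k} \<inter> {x. cell_index x = 0}" for k
    by (auto simp: S'_def)
  have S: "S k \<in> sets borel" and S': "S' k \<in> sets borel" for k
    unfolding S_eq S'_eq by (intro sets.Int B M1 M2)+
  have SS': "emeasure lborel (S k) = emeasure lborel (S' k)" for k
  proof -
    have "cell_index (real_vec k + x - a) = cell_index (x - a) + k" "cell_index (real_vec k + x) = cell_index x + k"
      "real_vec k + x \<in> B \<longleftrightarrow> x \<in> B" for x
      using cell_index_shift[of "x - a" k] cell_index_shift[of x k] per[of x k] by (simp_all add: algebra_simps)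
    then have "{x. real_vec k + x \<in> S k} = S' k"
      by (auto simp: S_def S'_def add_eq_0_iff)
    then show ?thesis using translate[OF S, of "real_vec k" k] by (simp only:)
  qed
  have "emeasure lborel {x. cell_index x = 0 \<and> x + a \<in> B} = emeasure lborel {x. a + x \<in> (B \<inter> {x. cell_index (x - a) = 0})}"
    by (auto intro!: arg_cong[where f="emeasure lborel"] simp: add.commute)
  also have "\<dots> = emeasure lborel (B \<inter> {x. cell_index (x - a) = 0})"
    by (rule translate) (intro sets.Int B M2)
  also have "B \<inter> {x. cell_index (x - a) = 0} = (\<Union>k. S k)"
    by (auto simp: S_def)
  also have "emeasure lborel (\<Union>k. S k) = (\<integral>\<^sup>+k. emeasure lborel (S k) \<partial>count_space UNIV)"
    by (rule emeasure_UN_countable) (use S in \<open>auto simp: disjoint_family_on_def S_eq\<close>)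
  also have "\<dots> = (\<integral>\<^sup>+k. emeasure lborel (S' k) \<partial>count_space UNIV)"
    by (simp add: SS')
  also have "\<dots> = emeasure lborel (\<Union>k. S' k)"
    by (rule emeasure_UN_countable[symmetric]) (use S' in \<open>auto simp: disjoint_family_on_def S'_eq\<close>)
  also have "(\<Union>k. S' k) = {x. cell_index x = 0 \<and> x \<in> B}"
  proof -
    have "\<exists>k. cell_index (x - a) = - k" for x by (metis minus_minus)
    then show ?thesis by (auto simp: S'_def)
  qed
  finally show ?thesis .
qed

lemma periodicD: "periodic f \<Longrightarrow> f (x + real_vec k) = f x"
  by (simp add: periodic_def)

lemma borel_measurable_reduce: "(\<lambda>x. x - real_vec (cell_index x)) \<in> borel_measurable borel"
proof (rule borel_measurable_euclidean_space[THEN iffD2], rule ballI)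
  fix b :: "real ^ 'a" assume "b \<in> Basis"
  then obtain i where b: "b = axis i 1" by (auto simp: Basis_vec_def)
  have "(\<lambda>x. (x - real_vec (cell_index x)) \<bullet> b) = (\<lambda>x. x $ i - of_int \<lfloor>x $ i + 1/2\<rfloor>)"
    by (auto simp: b inner_axis cell_index_def)
  also have "\<dots> \<in> borel_measurable borel"
    by (intro borel_measurable_diff measurable_compose[OF _ borel_measurable_real_floor]
        borel_measurable_continuous_onI continuous_intros)
  finally show "(\<lambda>x. (x - real_vec (cell_index x)) \<bullet> b) \<in> borel_measurable borel" .
qed

text \<open>A periodic \<open>f\<close> equals \<open>f\<close> composed with the reduction
  \<open>r\<close> to the half-open cell. Both sides are thus integrals of the same \<open>f\<close>
  against two push-forwards of the cell measure, and these agree because preimages of sets under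
  \<open>r\<close> are lattice-invariant, where \<open>emeasure_torus_shift\<close> applies. No
  approximation of \<open>f\<close> is required.\<close>

lemma torus_integral_shift:
  fixes f :: "real ^ 'd::finite \<Rightarrow> 'b::{banach, second_countable_topology}"
  assumes per: "periodic f" and f: "f \<in> borel_measurable borel"
  shows "torus_integral (\<lambda>x. f (x + a)) = torus_integral f"
proof -
  define r :: "real ^ 'd \<Rightarrow> real ^ 'd" where "r x = x - real_vec (cell_index x)" for x
  have r: "r \<in> borel_measurable borel" unfolding r_def[abs_def] by (rule borel_measurable_reduce)
  have shift: "(\<lambda>x. x + b) \<in> borel_measurable borel" for b :: "real ^ 'd"
    by (intro borel_measurable_continuous_onI continuous_intros)
  have rshift: "(\<lambda>x. r (x + b)) \<in> borel_measurable torus_measure" for b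
    by (intro measurable_torus_measure measurable_compose[OF shift r])
  have fr: "f (r x) = f x" for x
    using periodicD[OF per, of x "- cell_index x"] by (simp add: r_def)
  have rper: "r (x + real_vec k) = r x" for x k
    by (simp add: r_def cell_index_shift)
  have "distr torus_measure borel (\<lambda>x. r (x + b)) = distr torus_measure borel r" for b
  proof (rule measure_eqI)
    fix A assume "A \<in> sets (distr torus_measure borel (\<lambda>x. r (x + b)))"
    then have A: "A \<in> sets borel" by simp
    define B where "B = {x. r x \<in> A}"
    have "r -` A \<inter> space borel \<in> sets borel" by (rule measurable_sets[OF r A])
    then have B: "B \<in> sets borel" by (simp add: B_def vimage_def)
    have *: "emeasure (distr torus_measure borel (\<lambda>x. r (x + b))) A = emeasure lborel {x. cell_index x = 0 \<and> x + b \<in> B}" for b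
    proof -
      have "(\<lambda>x. x + b) -` B \<inter> space borel \<in> sets borel"
        by (rule measurable_sets[OF shift B])
      then have Bb: "{x. x + b \<in> B} \<in> sets borel" by (simp add: vimage_def)
      have Q: "{x. cell_index x = 0} \<in> sets borel"
        by (rule sets_cell_index[of 0, unfolded diff_zero])
      have "emeasure (distr torus_measure borel (\<lambda>x. r (x + b))) A = emeasure torus_measure (torus_cell \<inter> {x. x + b \<in> B})"
      proof (subst emeasure_distr)
        show "(\<lambda>x. r (x + b)) \<in> borel_measurable torus_measure" by (rule rshift)
      qed (simp_all add: A torus_measure_def space_restrict_space B_def vimage_def Int_commute)
      also have "\<dots> = emeasure lborel (torus_cell \<inter> {x. x + b \<in> B})"
        unfolding torus_measure_def by (rule emeasure_restrict_space) (simp_all add: torus_cell_def)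
      also have "\<dots> = emeasure lborel ({x. cell_index x = 0} \<inter> {x. x + b \<in> B})"
      proof (rule emeasure_eq_AE)
        show "AE x in lborel. x \<in> torus_cell \<inter> {x. x + b \<in> B} \<longleftrightarrow> x \<in> {x. cell_index x = 0} \<inter> {x. x + b \<in> B}"
          using AE_cell_index by (rule eventually_mono) blast
        show "{x. cell_index x = 0} \<inter> {x. x + b \<in> B} \<in> sets lborel"
          unfolding sets_lborel by (intro sets.Int Q Bb)
        show "torus_cell \<inter> {x. x + b \<in> B} \<in> sets lborel"
          unfolding sets_lborel torus_cell_def by (intro sets.Int Bb borel_closed closed_cbox)
      qed
      finally show ?thesis by (simp add: Collect_conj_eq)
    qed
    from *[of b] *[of 0] emeasure_torus_shift[OF B, of b]
    show "emeasure (distr torus_measure borel (\<lambda>x. r (x + b))) A = emeasure (distr torus_measure borel r) A"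
      by (simp add: B_def rper)
  qed simp
  then have "integral\<^sup>L (distr torus_measure borel (\<lambda>x. r (x + a))) f = integral\<^sup>L (distr torus_measure borel r) f"
    by simp
  then show ?thesis
    unfolding torus_integral_eq
    by (simp add: integral_distr[OF rshift f] integral_distr[OF measurable_torus_measure[OF r] f] fr)
qed

lemma torus_integral_reflect:
  fixes f :: "real ^ 'd::finite \<Rightarrow> 'b::{banach, second_countable_topology}"
  assumes [measurable]: "f \<in> borel_measurable borel"
  shows "torus_integral (\<lambda>x. f (- x)) = torus_integral f"
proof -
  have eq: "distr lborel borel (\<lambda>x::real ^ 'd. - x) = lborel"
    by (subst lborel_affine[of "-1" 0]) (auto simp: density_1 one_ennreal_def[symmetric])
  have cell: "- x \<in> torus_cell \<longleftrightarrow> x \<in> torus_cell" for x :: "real ^ 'd"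
    unfolding torus_cell_def mem_box_cart by (auto simp: minus_le_iff le_minus_iff)
  have [measurable]: "torus_cell \<in> sets (borel :: (real ^ 'd) measure)" by (simp add: torus_cell_def)
  have "torus_integral f = (LINT x|distr lborel borel (\<lambda>x::real ^ 'd. - x). indicator torus_cell x *\<^sub>R f x)"
    unfolding torus_integral_def set_lebesgue_integral_def eq ..
  also have "\<dots> = torus_integral (\<lambda>x. f (- x))"
    unfolding torus_integral_def set_lebesgue_integral_def
    by (subst integral_distr) (auto simp: indicator_def cell)
  finally show ?thesis ..
qed

lemma torus_integral_reflect_shift:
  fixes f :: "real ^ 'd::finite \<Rightarrow> 'b::{banach, second_countable_topology}"
  assumes per: "periodic f" and [measurable]: "f \<in> borel_measurable borel"
  shows "torus_integral (\<lambda>y. f (x - y)) = torus_integral f"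
proof -
  have "torus_integral (\<lambda>y. f (x - y)) = torus_integral (\<lambda>y. (\<lambda>z. f (z + x)) (- y))"
    by simp
  also have "\<dots> = torus_integral (\<lambda>z. f (z + x))"
    by (rule torus_integral_reflect) measurable
  finally show ?thesis by (simp add: torus_integral_shift assms)
qed

section \<open>Parseval identity on the torus\<close>

lemma integrable_torus_continuous:
  fixes f :: "real ^ 'd::finite \<Rightarrow> 'b::{banach, second_countable_topology}"
  assumes "continuous_on UNIV f"
  shows "integrable torus_measure f"
  unfolding torus_measure_def
proof (subst integrable_restrict_space)
  show "integrable lborel (\<lambda>x. indicator torus_cell x *\<^sub>R f x)"
    using assms continuous_on_subset unfolding torus_cell_def
    by (intro borel_integrable_compact) (auto intro: continuous_on_subset)
qed (simp add: torus_cell_def)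

section \<open>Characters and their orthonormality\<close>

definition character :: "int ^ 'd \<Rightarrow> real ^ 'd \<Rightarrow> complex" where
  "character n x = cis (2 * pi * (real_vec n \<bullet> x))"

text \<open>The complex-valued counterpart of \<open>fourier_coeff\<close>, which accepts only real
  functions; characters and differences with trigonometric polynomials are complex.\<close>

definition cfourier :: "(real ^ 'd \<Rightarrow> complex) \<Rightarrow> int ^ 'd \<Rightarrow> complex" where
  "cfourier g n = torus_integral (\<lambda>x. g x * cnj (character n x))"

lemma character_0 [simp]: "character 0 x = 1"
  and character_add: "character (n + m) x = character n x * character m x"
  and character_uminus: "character (- n) x = cnj (character n x)"
  and character_arg_add: "character n (x + y) = character n x * character n y"
  and character_arg_uminus: "character n (- x) = cnj (character n x)"
  and norm_character [simp]: "norm (character n x) = 1"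
  by (simp_all add: character_def cis_mult cis_cnj algebra_simps)

lemma continuous_character [continuous_intros]:
  "continuous_on A f \<Longrightarrow> continuous_on A (\<lambda>x. character n (f x))"
  unfolding character_def by (intro continuous_intros)

lemma periodic_character: "periodic (character n)"
proof -
  have "real_vec n \<bullet> real_vec k = of_int (\<Sum>i\<in>UNIV. n $ i * k $ i)" for k
    by (simp add: inner_vec_def)
  then have "character n (real_vec k) = 1" for k
    unfolding character_def by (metis Ints_of_int cis_multiple_2pi)
  then show ?thesis by (simp add: periodic_def character_arg_add)
qed

lemma fourier_coeff_eq: "fourier_coeff h n = cfourier (\<lambda>x. of_real (h x)) n"
  by (simp add: fourier_coeff_def cfourier_def character_def cis_cnj[symmetric] cis_conv_exp exp_cnj mult_ac)

lemma borel_measurable_character: "character n \<in> borel_measurable borel"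
  by (intro borel_measurable_continuous_onI continuous_intros)

lemma torus_integral_character: "torus_integral (character n) = (if n = 0 then 1 else 0)"
proof (cases "n = 0")
  case True
  have "character 0 = (\<lambda>x :: real ^ 'a. 1)" by (simp add: fun_eq_iff)
  then show ?thesis
    using True by (simp add: torus_integral_eq measure_torus_space)
next
  case False
  then obtain i where i: "n $ i \<noteq> 0" by (auto simp: vec_eq_iff)
  \<comment> \<open>A shift by half a period in direction \<open>i\<close> changes the sign of the character.\<close>
  define a :: "real ^ 'a" where "a = axis i (1 / (2 * n $ i))"
  have "real_vec n \<bullet> a = 1/2"
    using i by (simp add: a_def inner_axis)
  then have "2 * pi * (real_vec n \<bullet> a) = pi" by simp
  then have "character n a = -1" by (simp only: character_def cis_pi)
  then have "torus_integral (\<lambda>x. character n (x + a)) = - torus_integral (character n)"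
    by (simp add: character_arg_add torus_integral_eq)
  then have "torus_integral (character n) = - torus_integral (character n)"
    using torus_integral_shift[OF periodic_character borel_measurable_character, of n a] by simp
  then show ?thesis using False by (simp add: equal_neg_zero)
qed

lemma cfourier_character: "cfourier (character m) n = (if n = m then 1 else 0)"
proof -
  have "cfourier (character m) n = torus_integral (character (m - n))"
    unfolding cfourier_def
    by (rule arg_cong[where f=torus_integral]) (simp add: fun_eq_iff character_add character_uminus flip: add_uminus_conv_diff)
  then show ?thesis by (auto simp: torus_integral_character)
qed

lemma cfourier_diff:
  assumes "continuous_on UNIV f" "continuous_on UNIV g"
  shows "cfourier (\<lambda>x. f x - g x) n = cfourier f n - cfourier g n"
  unfolding cfourier_def torus_integral_eq left_diff_distrib
  by (intro Bochner_Integration.integral_diff integrable_torus_continuous continuous_intros assms)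

lemma cfourier_add:
  assumes "continuous_on UNIV f" "continuous_on UNIV g"
  shows "cfourier (\<lambda>x. f x + g x) n = cfourier f n + cfourier g n"
  unfolding cfourier_def torus_integral_eq distrib_right
  by (intro Bochner_Integration.integral_add integrable_torus_continuous continuous_intros assms)

lemma cfourier_scale: "cfourier (\<lambda>x. c * f x) n = c * cfourier f n"
  by (simp add: cfourier_def torus_integral_eq mult.assoc)

section \<open>Distance to a finite span of characters\<close>

definition torus_sqnorm :: "(real ^ 'd::finite \<Rightarrow> complex) \<Rightarrow> real" where
  "torus_sqnorm f = torus_integral (\<lambda>x. (norm (f x))\<^sup>2)"

text \<open>Completing the square in \<open>c\<close>: a character has modulus 1 on a torus of
  volume 1, so the quadratic term is the squared modulus of \<open>c\<close>, and the cross term is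
  the Fourier coefficient.\<close>

lemma torus_sqnorm_diff_character:
  assumes f: "continuous_on UNIV f"
  shows "torus_sqnorm (\<lambda>x. f x - c * character n x) =
    torus_sqnorm f - (norm (cfourier f n))\<^sup>2 + (norm (cfourier f n - c))\<^sup>2"
proof -
  have expand: "(norm (z - w))\<^sup>2 = (norm z)\<^sup>2 - 2 * Re (cnj w * z) + (norm w)\<^sup>2" for z w :: complex
    unfolding cmod_power2 by (simp add: algebra_simps power2_eq_square)
  have i1: "integrable torus_measure (\<lambda>x. (norm (f x))\<^sup>2)"
    and i2: "integrable torus_measure (\<lambda>x. f x * cnj (character n x))"
    by (intro integrable_torus_continuous continuous_intros f)+
  have "torus_sqnorm (\<lambda>x. f x - c * character n x) =
      torus_integral (\<lambda>x. (norm (f x))\<^sup>2 - 2 * Re (cnj c * (f x * cnj (character n x))) + (norm c)\<^sup>2)"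
    unfolding torus_sqnorm_def expand by (simp add: norm_mult mult_ac)
  also have "\<dots> = torus_sqnorm f - 2 * Re (cnj c * cfourier f n) + (norm c)\<^sup>2"
    unfolding torus_integral_eq cfourier_def torus_sqnorm_def
    using i1 i2 by (simp add: measure_torus_space del: times_complex.sel)
  finally show ?thesis by (simp add: expand)
qed

text \<open>Characters are subtracted one at a time; by orthogonality, removing a multiple of one
  leaves the other coefficients unchanged. Taking the Fourier coefficients for \<open>c\<close>
  yields Bessel's inequality, and an arbitrary \<open>c\<close> can only increase the
  distance.\<close>

lemma torus_sqnorm_diff_trig_poly:
  assumes "finite S" and "continuous_on UNIV f"
  shows "torus_sqnorm (\<lambda>x. f x - (\<Sum>n\<in>S. c n * character n x)) =
    torus_sqnorm f - (\<Sum>n\<in>S. (norm (cfourier f n))\<^sup>2) + (\<Sum>n\<in>S. (norm (cfourier f n - c n))\<^sup>2)"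
  using assms
proof (induction S arbitrary: f rule: finite_induct)
  case (insert m F)
  let ?g = "\<lambda>x. f x - c m * character m x"
  have g: "continuous_on UNIV ?g" by (intro continuous_intros insert.prems)
  have "cfourier ?g n = cfourier f n" if "n \<in> F" for n
    using that insert.hyps insert.prems
    by (subst cfourier_diff) (auto intro!: continuous_intros simp: cfourier_scale cfourier_character)
  then show ?case
    using insert.IH[OF g] insert.hyps
    by (simp add: torus_sqnorm_diff_character[OF insert.prems] diff_diff_eq)
qed simp

section \<open>Trigonometric polynomials and uniform approximation\<close>

inductive trig_poly :: "(real ^ 'd::finite \<Rightarrow> complex) \<Rightarrow> bool" where
  character: "trig_poly (\<lambda>x. c * character n x)"
| add: "trig_poly f \<Longrightarrow> trig_poly g \<Longrightarrow> trig_poly (\<lambda>x. f x + g x)"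

lemma trig_poly_const: "trig_poly (\<lambda>x. c)"
  using trig_poly.character[of c 0] by simp

lemma trig_poly_mult:
  assumes "trig_poly f" "trig_poly g"
  shows "trig_poly (\<lambda>x. f x * g x)"
  using assms(1)
proof induction
  case (character c n)
  show ?case using assms(2)
  proof induction
    case (character c' n')
    show ?case using trig_poly.character[of "c * c'" "n + n'"]
      by (simp add: character_add mult_ac)
  next
    case (add f g)
    then show ?case using trig_poly.add[OF add.IH] by (simp add: distrib_left)
  qed
next
  case (add f g)
  then show ?case using trig_poly.add[OF add.IH] by (simp add: distrib_right)
qed

lemma trig_poly_sum: "(\<And>i. i \<in> A \<Longrightarrow> trig_poly (f i)) \<Longrightarrow> trig_poly (\<lambda>x. \<Sum>i\<in>A. f i x)"
  by (induction A rule: infinite_finite_induct) (auto intro: trig_poly_const trig_poly.add)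

text \<open>The inductive form is convenient for products; the distance formula needs distinct
  frequencies, hence a sum over a set.\<close>

lemma trig_poly_finite_sum:
  assumes "trig_poly p"
  obtains S c where "finite S" "p = (\<lambda>x. \<Sum>n\<in>S. c n * character n x)"
proof -
  have "\<exists>S c. finite S \<and> p = (\<lambda>x. \<Sum>n\<in>S. c n * character n x)"
    using assms
  proof induction
    case (character c n)
    show ?case by (rule exI[of _ "{n}"], rule exI[of _ "\<lambda>_. c"]) simp
  next
    case (add f g)
    then obtain S c T d where *: "finite S" "f = (\<lambda>x. \<Sum>n\<in>S. c n * character n x)"
      "finite T" "g = (\<lambda>x. \<Sum>n\<in>T. d n * character n x)" by blast
    \<comment> \<open>Padding by zero makes the coefficients of frequencies common to
      \<open>S\<close> and \<open>T\<close> add up.\<close>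
    let ?c = "\<lambda>n. (if n \<in> S then c n else 0) + (if n \<in> T then d n else 0)"
    have "(\<Sum>n\<in>S \<union> T. ?c n * character n x) = f x + g x" for x
      using * by (simp add: distrib_right sum.distrib if_distrib[of "\<lambda>z. z * _"] sum.If_cases Int_absorb1 cong: if_cong)
    then show ?case using * by (intro exI[of _ "S \<union> T"] exI[of _ ?c]) auto
  qed
  then show ?thesis using that by blast
qed

definition torus_embedding :: "real ^ 'd \<Rightarrow> complex ^ 'd::finite" where
  "torus_embedding x = (\<chi> i. cis (2 * pi * x $ i))"

lemma torus_embedding_eqD:
  assumes "torus_embedding x = torus_embedding y"
  obtains k where "x = y + real_vec k"
proof -
  have "\<exists>k::int. x $ i = y $ i + of_int k" for i
  proof -
    have "cis (2 * pi * (x $ i)) = cis (2 * pi * (y $ i))"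
      using assms by (simp add: torus_embedding_def vec_eq_iff)
    then have "exp (\<i> * complex_of_real (2 * pi * (x $ i))) = exp (\<i> * complex_of_real (2 * pi * (y $ i)))"
      by (simp only: cis_conv_exp)
    then obtain m :: int where "\<i> * complex_of_real (2 * pi * (x $ i)) = \<i> * complex_of_real (2 * pi * (y $ i)) + (of_int (2 * m) * pi) * \<i>"
      unfolding exp_eq by blast
    then have "2 * pi * (x $ i) = 2 * pi * (y $ i) + 2 * of_int m * pi"
      by (simp add: complex_eq_iff)
    then have "2 * pi * (x $ i) = 2 * pi * (y $ i + of_int m)" by (simp add: algebra_simps)
    then show ?thesis by (intro exI[of _ m]) simp
  qed
  then obtain k :: "'a \<Rightarrow> int" where "\<And>i. x $ i = y $ i + of_int (k i)" by metis
  then have "x = y + real_vec (\<chi> i. k i)" by (simp add: vec_eq_iff)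
  then show ?thesis by (rule that)
qed

text \<open>A real linear functional of the embedded point is a combination of cosines and sines of
  single coordinates, that is, of characters with frequencies plus and minus a unit vector.
  Constants, sums and products stay in the class.\<close>

lemma trig_poly_polynomial_torus_embedding:
  fixes q :: "complex ^ 'd::finite \<Rightarrow> real"
  assumes "real_polynomial_function q"
  shows "trig_poly (\<lambda>x. of_real (q (torus_embedding x)))"
  using assms
proof induction
  case (linear h)
  interpret h: bounded_linear h by (rule linear)
  have E: "torus_embedding x = (\<Sum>i\<in>UNIV. cos (2 * pi * x $ i) *\<^sub>R axis i 1 + sin (2 * pi * x $ i) *\<^sub>R axis i \<i>)"
    for x :: "real ^ 'd"
    by (auto simp: torus_embedding_def vec_eq_iff axis_def complex_eq_iff sum.distrib if_distrib if_distribR cong: if_cong)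
  have tp: "trig_poly (\<lambda>x. of_real (cos (2 * pi * x $ i) * a + sin (2 * pi * x $ i) * b))" for i :: 'd and a b
  proof -
    let ?n = "axis i (1::int) :: int ^ 'd"
    have [simp]: "real_vec (axis i (1::int)) = axis i (1::real)"
      by (simp add: vec_eq_iff axis_def)
    have "complex_of_real (cos (2 * pi * x $ i) * a + sin (2 * pi * x $ i) * b) =
        ((a - \<i> * b) / 2) * character ?n x + ((a + \<i> * b) / 2) * character (- ?n) x" for x
      by (simp add: character_def inner_axis' complex_eq_iff field_simps)
    then show ?thesis by (simp only:) (intro trig_poly.intros)
  qed
  show ?case
    unfolding E h.sum h.add h.scaleR
    using trig_poly_sum[of UNIV "\<lambda>i x. of_real (cos (2 * pi * x $ i) * h (axis i 1) + sin (2 * pi * x $ i) * h (axis i \<i>))"] tp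
    by simp
next
  case (const c)
  show ?case by (rule trig_poly_const)
next
  case (add f g)
  then show ?case using trig_poly.add by simp
next
  case (mult f g)
  then show ?case using trig_poly_mult by simp
qed

lemma reduce_in_torus_cell: "x - real_vec (cell_index x) \<in> torus_cell"
proof -
  have "- (1/2) \<le> t - of_int \<lfloor>t + 1/2\<rfloor>" "t - of_int \<lfloor>t + 1/2\<rfloor> \<le> 1/2" for t :: real
    by linarith+
  then show ?thesis by (simp add: torus_cell_def mem_box_cart cell_index_def)
qed

lemma periodic_cell_representative:
  fixes f :: "real ^ 'd::finite \<Rightarrow> 'b"
  assumes "periodic f"
  obtains y where "y \<in> torus_cell" "f y = f x" "torus_embedding y = torus_embedding x"
proof -
  let ?y = "x - real_vec (cell_index x)"
  have "f ?y = f x" using periodicD[OF assms, of ?y "cell_index x"] by simp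
  moreover have "torus_embedding ?y = torus_embedding x"
    by (simp add: torus_embedding_def vec_eq_iff right_diff_distrib cis_divide[symmetric])
  ultimately show ?thesis using that[OF reduce_in_torus_cell] by blast
qed

text \<open>A periodic function factors through the compact image of the cell under
  \<open>torus_embedding\<close>, and polynomials in the coordinates there are trigonometric polynomials.\<close>

lemma trig_poly_approximation:
  fixes f :: "real ^ 'd::finite \<Rightarrow> real"
  assumes f: "continuous_on UNIV f" and per: "periodic f" and e: "e > 0"
  obtains p where "trig_poly p" "\<And>x. norm (of_real (f x) - p x) < e"
proof -
  let ?E = "torus_embedding :: real ^ 'd \<Rightarrow> complex ^ 'd"
  \<comment> \<open>The chosen preimage need not depend continuously on \<open>z\<close>. Any two
    preimages differ by a lattice vector, so the value of \<open>f\<close> does not depend on the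
    choice.\<close>
  define g where "g z = f (inv_into torus_cell ?E z)" for z
  have gE: "g (?E x) = f x" for x
  proof -
    obtain y where y: "y \<in> torus_cell" "f y = f x" "?E y = ?E x"
      using periodic_cell_representative[OF per] by metis
    then have "?E (inv_into torus_cell ?E (?E x)) = ?E x" by (metis f_inv_into_f imageI)
    then obtain k where "inv_into torus_cell ?E (?E x) = x + real_vec k" by (rule torus_embedding_eqD)
    then show ?thesis by (simp add: g_def periodicD[OF per])
  qed
  have contE: "continuous_on A ?E" for A
    unfolding torus_embedding_def by (intro continuous_intros)
  have cell: "compact (torus_cell :: (real ^ 'd) set)" by (simp add: torus_cell_def)
  have K: "compact (?E ` torus_cell)" by (rule compact_continuous_image[OF contE cell])
  \<comment> \<open>Continuity without a continuous inverse: the preimage of a closed set under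
    \<open>g\<close> is the image of a compact part of the cell, hence closed.\<close>
  have "continuous_on (?E ` torus_cell) g"
  proof (subst continuous_on_closed_vimage[OF compact_imp_closed[OF K]], intro allI impI)
    fix B :: "real set" assume "closed B"
    then have "closed (f -` B)" using f by (simp add: continuous_on_closed_vimage)
    then have "compact (?E ` (torus_cell \<inter> f -` B))"
      by (intro compact_continuous_image contE compact_Int_closed cell)
    moreover have "g -` B \<inter> ?E ` torus_cell = ?E ` (torus_cell \<inter> f -` B)"
      by (auto simp: gE)
    ultimately show "closed (g -` B \<inter> ?E ` torus_cell)" by (simp add: compact_imp_closed)
  qed
  then obtain q where q: "real_polynomial_function q" "\<And>z. z \<in> ?E ` torus_cell \<Longrightarrow> \<bar>g z - q z\<bar> < e"
    using Stone_Weierstrass_real_polynomial_function[OF K _ e] by metis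
  have "norm (of_real (f x) - complex_of_real (q (?E x))) < e" for x
  proof -
    have "?E x \<in> ?E ` torus_cell" using periodic_cell_representative[OF per] by (metis imageI)
    then show ?thesis using q(2)[of "?E x"] by (simp add: gE flip: of_real_diff)
  qed
  then show ?thesis using that trig_poly_polynomial_torus_embedding[OF q(1)] by blast
qed

text \<open>Finite partial sums are bounded by the integral (Bessel) and increase with the index
  set, so one finite set with small deficit controls all larger ones. A uniform
  \<open>e\<close>-approximant supplies such a set with deficit at most \<open>e\<^sup>2\<close>,
  since the volume is 1.\<close>

theorem parseval:
  fixes f :: "real ^ 'd::finite \<Rightarrow> real"
  assumes f: "continuous_on UNIV f" and per: "periodic f"
  shows "((\<lambda>n. (norm (fourier_coeff f n))\<^sup>2) has_sum torus_integral (\<lambda>x. (f x)\<^sup>2)) UNIV"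
proof -
  let ?f = "\<lambda>x. complex_of_real (f x)" and ?a = "\<lambda>n. (norm (fourier_coeff f n))\<^sup>2"
  let ?I = "torus_integral (\<lambda>x. (f x)\<^sup>2)"
  have cf: "continuous_on UNIV ?f" by (intro continuous_intros f)
  have I: "torus_sqnorm ?f = ?I" by (simp add: torus_sqnorm_def)
  have nonneg: "torus_sqnorm g \<ge> 0" for g :: "real ^ 'd \<Rightarrow> complex"
    unfolding torus_sqnorm_def torus_integral_eq by (intro integral_nonneg_AE) simp
  have bessel: "sum ?a S \<le> ?I" if "finite S" for S
    using torus_sqnorm_diff_trig_poly[OF that cf, of "cfourier ?f"] nonneg[of "\<lambda>x. ?f x - (\<Sum>n\<in>S. cfourier ?f n * character n x)"]
    by (simp add: I fourier_coeff_eq)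
  have approx: "\<exists>S. finite S \<and> ?I - sum ?a S \<le> e\<^sup>2" if e: "e > 0" for e
  proof -
    obtain p where p: "trig_poly p" "\<And>x. norm (?f x - p x) < e"
      using trig_poly_approximation[OF f per e] by blast
    obtain S c where S: "finite S" and ps: "p = (\<lambda>x. \<Sum>n\<in>S. c n * character n x)"
      using trig_poly_finite_sum[OF p(1)] by blast
    have cp: "continuous_on UNIV p" unfolding ps by (intro continuous_intros)
    have "torus_sqnorm (\<lambda>x. ?f x - p x) \<le> torus_integral (\<lambda>x :: real ^ 'd. e\<^sup>2)"
      unfolding torus_sqnorm_def torus_integral_eq
    proof (rule Bochner_Integration.integral_mono)
      show "integrable torus_measure (\<lambda>x. (norm (?f x - p x))\<^sup>2)"
        by (intro integrable_torus_continuous continuous_intros cf cp)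
      show "(norm (?f x - p x))\<^sup>2 \<le> e\<^sup>2" for x
        by (rule power_mono[OF less_imp_le[OF p(2)] norm_ge_zero])
    qed simp
    also have "\<dots> = e\<^sup>2" by (simp add: torus_integral_eq measure_torus_space)
    finally have "?I - sum ?a S + (\<Sum>n\<in>S. (norm (cfourier ?f n - c n))\<^sup>2) \<le> e\<^sup>2"
      using torus_sqnorm_diff_trig_poly[OF S cf, of c] by (simp add: ps I fourier_coeff_eq)
    \<comment> \<open>Dropping this term replaces the coefficients of the approximant by the Fourier
      coefficients of \<open>f\<close> on the same frequencies.\<close>
    moreover have "(\<Sum>n\<in>S. (norm (cfourier ?f n - c n))\<^sup>2) \<ge> 0" by (intro sum_nonneg) simp
    ultimately show ?thesis using S by (intro exI[of _ S]) simp
  qed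
  show ?thesis
    unfolding has_sum_def tendsto_iff eventually_finite_subsets_at_top
  proof (intro allI impI)
    fix e :: real assume e: "e > 0"
    \<comment> \<open>The square root turns the quadratic deficit into e/2, which is strictly below
      e.\<close>
    obtain S where S: "finite S" "?I - sum ?a S \<le> (sqrt (e/2))\<^sup>2" using approx[of "sqrt (e/2)"] e by auto
    have "dist (sum ?a Y) ?I < e" if "finite Y" "S \<subseteq> Y" for Y
    proof -
      have "sum ?a S \<le> sum ?a Y" using that by (intro sum_mono2) auto
      then show ?thesis using S e bessel[OF that(1)] by (simp add: dist_real_def)
    qed
    then show "\<exists>X. finite X \<and> X \<subseteq> UNIV \<and> (\<forall>Y. finite Y \<and> X \<subseteq> Y \<and> Y \<subseteq> UNIV \<longrightarrow> dist (sum ?a Y) ?I < e)"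
      using S(1) by blast
  qed
qed

section \<open>Convolution with the kernel\<close>

lemma integrable_torus_bounded:
  fixes f :: "real ^ 'd::finite \<Rightarrow> 'b::{banach, second_countable_topology}"
  assumes "f \<in> borel_measurable borel" "\<And>x. norm (f x) \<le> B"
  shows "integrable torus_measure f"
  using assms by (intro torus.integrable_const_bound[of _ B] measurable_torus_measure) auto

lemma periodic_continuous_bounded:
  fixes f :: "real ^ 'd::finite \<Rightarrow> 'b::real_normed_vector"
  assumes "continuous_on UNIV f" "periodic f"
  obtains C where "C > 0" "\<And>x. norm (f x) \<le> C"
proof -
  have "compact (f ` torus_cell)"
    by (rule compact_continuous_image[OF continuous_on_subset[OF assms(1)]]) (auto simp: torus_cell_def)
  then obtain C where C: "C > 0" "\<And>x. x \<in> torus_cell \<Longrightarrow> norm (f x) \<le> C"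
    using compact_imp_bounded bounded_pos by (metis imageI)
  have "norm (f x) \<le> C" for x
    using periodic_cell_representative[OF assms(2), of x] C(2) by metis
  then show ?thesis using that C(1) by blast
qed

text \<open>The radial profile is left behind here: its periodic extension becomes
  \<open>periodic\<close>, and its evenness has been converted into
  \<open>real_coeff\<close>.\<close>

locale torus_kernel =
  fixes W :: "real ^ 'd::finite \<Rightarrow> real"
  assumes periodic: "periodic W"
    and measurable: "W \<in> borel_measurable borel"
    and bounded: "bounded (range W)"
    and real_coeff: "fourier_coeff W n \<in> \<real>"
    and integral_1: "torus_integral W = 1"

lemma interaction_kernel_torus_kernel:
  fixes W :: "real ^ 'd::finite \<Rightarrow> real"
  assumes W: "interaction_kernel W"
  shows "torus_kernel W"
proof
  obtain w where ext: "\<And>x k. x \<in> torus_cell \<Longrightarrow> W (x + real_vec k) = w x"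
    using W unfolding interaction_kernel_def periodic_extension_def by blast
  show per: "periodic W"
    unfolding periodic_def
  proof (intro allI)
    fix x k
    show "W (x + real_vec k) = W x"
      using ext[OF reduce_in_torus_cell, of x "cell_index x + k"] ext[OF reduce_in_torus_cell, of x "cell_index x"]
      by simp
  qed
  show int1: "torus_integral W = 1" and "bounded (range W)"
    using W by (simp_all add: interaction_kernel_def)
  \<comment> \<open>Measurability is extracted from the normalization: a Bochner integral is 0 by
    convention when the integrand is not integrable, so the value 1 forces integrability on the
    cell.\<close>
  have "integrable lborel (\<lambda>x. indicator torus_cell x *\<^sub>R W x)"
    using int1 unfolding torus_integral_def set_lebesgue_integral_def
    by (metis not_integrable_integral_eq zero_neq_one)
  then have "(\<lambda>x. indicator torus_cell x *\<^sub>R W x) \<in> borel_measurable borel"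
    using borel_measurable_integrable by fastforce
  \<comment> \<open>Composing with the reduction map carries measurability from the cell to the
    whole space: the indicator is then constantly 1 and periodicity gives back
    \<open>W\<close>.\<close>
  then have "(\<lambda>x. indicator torus_cell (x - real_vec (cell_index x)) *\<^sub>R W (x - real_vec (cell_index x))) \<in> borel_measurable borel"
    by (rule measurable_compose[OF borel_measurable_reduce])
  moreover have "W (x - real_vec (cell_index x)) = W x" for x
    using periodicD[OF per, of "x - real_vec (cell_index x)" "cell_index x"] by simp
  ultimately show "W \<in> borel_measurable borel" by (simp add: reduce_in_torus_cell)
  show "fourier_coeff W n \<in> \<real>" for n
    by (rule fourier_coeff_kernel_real[OF W])
qed

context torus_kernel
begin

abbreviation What :: "int ^ 'd \<Rightarrow> real" where
  "What n \<equiv> Re (fourier_coeff W n)"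

lemma fourier_coeff_What: "fourier_coeff W n = of_real (What n)"
  using real_coeff by (simp add: of_real_Re)

lemma kernel_bound:
  obtains B where "B > 0" "\<And>x. \<bar>W x\<bar> \<le> B"
  using bounded by (auto simp: bounded_pos)

lemma conv_integrable:
  assumes "continuous_on UNIV \<eta>" "periodic \<eta>"
  shows "integrable torus_measure (\<lambda>z. W z * \<eta> (x - z))"
    and "integrable torus_measure (\<lambda>y. W (x - y) * \<eta> y)"
proof -
  obtain B where B: "B > 0" "\<And>x. \<bar>W x\<bar> \<le> B" by (rule kernel_bound) blast
  obtain C where C: "C > 0" "\<And>x. \<bar>\<eta> x\<bar> \<le> C"
    using periodic_continuous_bounded[OF assms] by auto
  have "(\<lambda>z. \<eta> (x - z)) \<in> borel_measurable borel"
    by (intro borel_measurable_continuous_onI continuous_on_compose2[OF assms(1)] continuous_intros) auto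
  then show "integrable torus_measure (\<lambda>z. W z * \<eta> (x - z))"
    using B C by (intro integrable_torus_bounded[where B="B * C"] borel_measurable_times measurable)
      (auto simp: abs_mult intro!: mult_mono)
  have "(\<lambda>y. x - y) \<in> borel_measurable borel"
    by (intro borel_measurable_continuous_onI continuous_intros)
  then have "(\<lambda>y. W (x - y)) \<in> borel_measurable borel"
    by (rule measurable_compose[OF _ measurable])
  then show "integrable torus_measure (\<lambda>y. W (x - y) * \<eta> y)"
    using B C by (intro integrable_torus_bounded[where B="B * C"] borel_measurable_times
        borel_measurable_continuous_onI[OF assms(1)]) (auto simp: abs_mult intro!: mult_mono)
qed

text \<open>Moves the translation from the possibly discontinuous kernel onto the continuous
  \<open>\<eta>\<close>, by reflection and translation invariance.\<close>

lemma conv_eq: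
  assumes "continuous_on UNIV \<eta>" "periodic \<eta>"
  shows "torus_conv W \<eta> x = torus_integral (\<lambda>z. W z * \<eta> (x - z))"
proof -
  let ?f = "\<lambda>z. W z * \<eta> (x - z)"
  have "periodic ?f"
    unfolding periodic_def
  proof (intro allI)
    fix z k
    have "\<eta> (x - (z + real_vec k)) = \<eta> (x - z)"
      using periodicD[OF assms(2), of "x - z" "- k"] by (simp add: algebra_simps)
    then show "?f (z + real_vec k) = ?f z" by (simp add: periodicD[OF periodic])
  qed
  moreover have "?f \<in> borel_measurable borel"
    by (intro borel_measurable_times measurable borel_measurable_continuous_onI
        continuous_on_compose2[OF assms(1)] continuous_intros) auto
  ultimately have "torus_integral (\<lambda>y. ?f (x - y)) = torus_integral ?f"
    by (rule torus_integral_reflect_shift)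
  then show ?thesis by (simp add: torus_conv_def)
qed

text \<open>Mass one of the kernel is what makes constants fixed points of the convolution. It
  renders the interaction energy quadratic in \<open>t\<close> and the argument of \<open>G\<close>
  affine in \<open>t\<close>.\<close>

lemma conv_affine:
  assumes "continuous_on UNIV \<eta>" "periodic \<eta>"
  shows "torus_conv W (\<lambda>y. a + t * \<eta> y) x = a + t * torus_conv W \<eta> x"
proof -
  \<comment> \<open>The factor 1 makes this an instance of \<open>conv_integrable\<close> for a
    constant function.\<close>
  have W: "integrable torus_measure (\<lambda>y. W (x - y) * 1)"
    by (rule conv_integrable) (auto simp: periodic_def)
  have "torus_conv W (\<lambda>y. a + t * \<eta> y) x =
      torus_integral (\<lambda>y. a * (W (x - y) * 1) + t * (W (x - y) * \<eta> y))"
    by (simp add: torus_conv_def algebra_simps)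
  also have "\<dots> = a * torus_integral (\<lambda>y. W (x - y)) + t * torus_conv W \<eta> x"
    using W conv_integrable(2)[OF assms, of x] by (simp add: torus_integral_eq torus_conv_def)
  also have "torus_integral (\<lambda>y. W (x - y)) = 1"
    using torus_integral_reflect_shift[OF periodic measurable] integral_1 by simp
  finally show ?thesis by simp
qed

lemma conv_periodic: "periodic (torus_conv W \<eta>)"
  unfolding periodic_def torus_conv_def
proof (intro allI)
  fix x k
  have "W (x + real_vec k - y) = W (x - y)" for y
    using periodicD[OF periodic, of "x - y" k] by (simp add: algebra_simps)
  then show "torus_integral (\<lambda>y. W (x + real_vec k - y) * \<eta> y) = torus_integral (\<lambda>y. W (x - y) * \<eta> y)"
    by simp
qed

text \<open>Dominated convergence: in the form of \<open>conv_eq\<close> the integrand depends on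
  the point only through the continuous \<open>\<eta>\<close>, and a constant dominates on a finite
  measure.\<close>

lemma conv_continuous:
  assumes \<eta>: "continuous_on UNIV \<eta>" "periodic \<eta>"
  shows "continuous_on UNIV (torus_conv W \<eta>)"
proof -
  obtain B where B: "B > 0" "\<And>x. \<bar>W x\<bar> \<le> B" by (rule kernel_bound) blast
  obtain C where C: "C > 0" "\<And>x. \<bar>\<eta> x\<bar> \<le> C"
    using periodic_continuous_bounded[OF \<eta>] by auto
  have "continuous (at x) (torus_conv W \<eta>)" for x
    unfolding continuous_at_sequentially
  proof (intro allI impI)
    fix X :: "nat \<Rightarrow> real ^ 'd" assume X: "X \<longlonglongrightarrow> x"
    have "(\<lambda>i. integral\<^sup>L torus_measure (\<lambda>z. W z * \<eta> (X i - z))) \<longlonglongrightarrow> integral\<^sup>L torus_measure (\<lambda>z. W z * \<eta> (x - z))"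
    proof (rule integral_dominated_convergence)
      show "integrable torus_measure (\<lambda>z :: real ^ 'd. B * C)" by simp
      show "AE z in torus_measure. norm (W z * \<eta> (X i - z)) \<le> B * C" for i
        using B C by (intro AE_I2) (auto simp: abs_mult intro!: mult_mono)
      have "isCont \<eta> y" for y
        using \<eta>(1) by (simp add: continuous_on_eq_continuous_at)
      then show "AE z in torus_measure. (\<lambda>i. W z * \<eta> (X i - z)) \<longlonglongrightarrow> W z * \<eta> (x - z)"
        using X by (intro AE_I2 tendsto_intros isCont_tendsto_compose[of _ \<eta>]) auto
    qed (intro borel_measurable_integrable conv_integrable \<eta>)+
    then show "(torus_conv W \<eta> \<circ> X) \<longlonglongrightarrow> torus_conv W \<eta> x"
      by (simp add: o_def conv_eq[OF \<eta>] torus_integral_eq)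
  qed
  then show ?thesis by (simp add: continuous_on_eq_continuous_at)
qed

lemma torus_integral_kernel_character:
  "torus_integral (\<lambda>z. of_real (W z) * cnj (character n z)) = of_real (What n)"
  using fourier_coeff_What[of n] by (simp add: fourier_coeff_eq cfourier_def)

lemma fourier_coeff_conv:
  assumes \<eta>: "continuous_on UNIV \<eta>" "periodic \<eta>"
  shows "fourier_coeff (torus_conv W \<eta>) n = of_real (What n) * fourier_coeff \<eta> n"
proof -
  obtain B where B: "B > 0" "\<And>x. \<bar>W x\<bar> \<le> B" by (rule kernel_bound) blast
  obtain C where C: "C > 0" "\<And>x. \<bar>\<eta> x\<bar> \<le> C"
    using periodic_continuous_bounded[OF \<eta>] by auto
  let ?T = "torus_measure :: (real ^ 'd) measure"
  let ?F = "\<lambda>x y. complex_of_real (W (x - y) * \<eta> y) * cnj (character n x)"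
  interpret P: pair_sigma_finite ?T ?T ..
  interpret PF: finite_measure "?T \<Otimes>\<^sub>M ?T"
    by (rule finite_measure_pair_measure) (rule torus.finite_measure_axioms)+
  have id: "(\<lambda>x. x) \<in> borel_measurable ?T"
    by (rule measurable_torus_measure) simp
  have fst: "fst \<in> borel_measurable (?T \<Otimes>\<^sub>M ?T)" and snd: "snd \<in> borel_measurable (?T \<Otimes>\<^sub>M ?T)"
    by (rule measurable_compose[OF measurable_fst id], rule measurable_compose[OF measurable_snd id])
  have meas_eta: "\<eta> \<in> borel_measurable borel"
    by (rule borel_measurable_continuous_onI[OF \<eta>(1)])
  have meas_char: "(\<lambda>x. cnj (character n x)) \<in> borel_measurable borel"
    by (intro borel_measurable_continuous_onI continuous_intros)
  have "(\<lambda>p. complex_of_real (W (fst p - snd p) * \<eta> (snd p)) * cnj (character n (fst p))) \<in> borel_measurable (?T \<Otimes>\<^sub>M ?T)"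
    by (intro borel_measurable_times borel_measurable_of_real
        measurable_compose[OF borel_measurable_diff[OF fst snd] measurable]
        measurable_compose[OF snd meas_eta] measurable_compose[OF fst meas_char]
        measurable_compose[OF _ borel_measurable_of_real])
  then have int: "integrable (?T \<Otimes>\<^sub>M ?T) (case_prod ?F)"
    using B C by (intro PF.integrable_const_bound[of _ "B * C"])
      (auto simp: norm_mult abs_mult case_prod_beta intro!: mult_mono)
  \<comment> \<open>For fixed \<open>y\<close>, translation by \<open>y\<close> turns the integral
    into the coefficient of \<open>W\<close> and splits off the conjugate character at
    \<open>y\<close>.\<close>
  have inner: "integral\<^sup>L ?T (\<lambda>x. ?F x y) = of_real (What n) * (of_real (\<eta> y) * cnj (character n y))" for y
  proof -
    let ?g = "\<lambda>x. complex_of_real (W (x - y)) * cnj (character n x)"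
    have gm: "?g \<in> borel_measurable borel"
      by (intro borel_measurable_times meas_char measurable_compose[OF _ borel_measurable_of_real]
          measurable_compose[OF _ measurable] borel_measurable_continuous_onI continuous_intros)
    have gp: "periodic ?g"
      unfolding periodic_def
    proof (intro allI)
      fix x k
      have "W (x + real_vec k - y) = W (x - y)"
        using periodicD[OF periodic, of "x - y" k] by (simp add: algebra_simps)
      then show "?g (x + real_vec k) = ?g x" by (simp add: periodicD[OF periodic_character])
    qed
    have "integral\<^sup>L ?T (\<lambda>x. ?F x y) = of_real (\<eta> y) * torus_integral ?g"
      unfolding torus_integral_eq by (subst integral_mult_right_zero[symmetric]) (simp add: mult_ac)
    also have "torus_integral ?g = torus_integral (\<lambda>x. ?g (x + y))"
      by (rule torus_integral_shift[OF gp gm, symmetric])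
    also have "\<dots> = cnj (character n y) * torus_integral (\<lambda>z. of_real (W z) * cnj (character n z))"
      unfolding torus_integral_eq by (subst integral_mult_right_zero[symmetric]) (simp add: mult_ac character_arg_add)
    finally show ?thesis by (simp add: torus_integral_kernel_character mult_ac)
  qed
  have "fourier_coeff (torus_conv W \<eta>) n = integral\<^sup>L ?T (\<lambda>x. integral\<^sup>L ?T (\<lambda>y. ?F x y))"
    by (simp add: fourier_coeff_eq cfourier_def torus_conv_def torus_integral_eq del: of_real_mult)
  also have "\<dots> = integral\<^sup>L ?T (\<lambda>y. integral\<^sup>L ?T (\<lambda>x. ?F x y))"
    using P.Fubini_integral[OF int] by simp
  also have "\<dots> = of_real (What n) * fourier_coeff \<eta> n"
    by (simp only: inner) (simp add: fourier_coeff_eq cfourier_def torus_integral_eq)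
  finally show ?thesis .
qed

text \<open>Parseval handles squares only, so the product is written as a quarter of the difference
  of the squares of \<open>\<eta>\<close> plus and minus its convolution. The coefficients of these
  are those of \<open>\<eta>\<close> times 1 + What and 1 - What.\<close>

lemma has_sum_conv:
  assumes \<eta>: "continuous_on UNIV \<eta>" "periodic \<eta>"
  shows "((\<lambda>n. What n * (norm (fourier_coeff \<eta> n))\<^sup>2) has_sum
    torus_integral (\<lambda>x. \<eta> x * torus_conv W \<eta> x)) UNIV"
proof -
  let ?v = "torus_conv W \<eta>"
  note v = conv_continuous[OF \<eta>] conv_periodic[of \<eta>]
  have p: "periodic (\<lambda>x. \<eta> x + ?v x)" "periodic (\<lambda>x. \<eta> x - ?v x)"
    using \<eta>(2) v(2) by (simp_all add: periodic_def)
  have c: "continuous_on UNIV (\<lambda>x. \<eta> x + ?v x)" "continuous_on UNIV (\<lambda>x. \<eta> x - ?v x)"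
    by (intro continuous_intros \<eta> v)+
  have cc: "continuous_on UNIV (\<lambda>x. complex_of_real (\<eta> x))" "continuous_on UNIV (\<lambda>x. complex_of_real (?v x))"
    by (intro continuous_intros \<eta> v)+
  have coeff: "fourier_coeff (\<lambda>x. \<eta> x + ?v x) n = (1 + of_real (What n)) * fourier_coeff \<eta> n"
    "fourier_coeff (\<lambda>x. \<eta> x - ?v x) n = (1 - of_real (What n)) * fourier_coeff \<eta> n" for n
    using fourier_coeff_conv[OF \<eta>, of n] cfourier_add[OF cc, of n] cfourier_diff[OF cc, of n]
    by (simp_all add: fourier_coeff_eq algebra_simps)
  \<comment> \<open>Because \<open>w\<close> is real, the two factors have moduli |1 + w| and |1 -
    w|, whose squares differ by 4 w.\<close>
  have nrm: "(norm ((1 + of_real w) * z))\<^sup>2 - (norm ((1 - of_real w) * z))\<^sup>2 = 4 * (w * (norm z)\<^sup>2)" for w and z :: complex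
  proof -
    have "norm (1 + complex_of_real w) = \<bar>1 + w\<bar>" "norm (1 - complex_of_real w) = \<bar>1 - w\<bar>"
      by (metis norm_of_real of_real_1 of_real_add, metis norm_of_real of_real_1 of_real_diff)
    then have "(norm ((1 + of_real w) * z))\<^sup>2 - (norm ((1 - of_real w) * z))\<^sup>2
        = (1 + w)\<^sup>2 * (norm z)\<^sup>2 - (1 - w)\<^sup>2 * (norm z)\<^sup>2"
      by (simp add: norm_mult power_mult_distrib)
    then show ?thesis by (simp add: power2_eq_square algebra_simps)
  qed
  have "((\<lambda>n. (norm (fourier_coeff (\<lambda>x. \<eta> x + ?v x) n))\<^sup>2 - (norm (fourier_coeff (\<lambda>x. \<eta> x - ?v x) n))\<^sup>2)
      has_sum (torus_integral (\<lambda>x. (\<eta> x + ?v x)\<^sup>2) - torus_integral (\<lambda>x. (\<eta> x - ?v x)\<^sup>2))) UNIV"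
    using has_sum_add[OF parseval[OF c(1) p(1)] has_sum_cmult_right[OF parseval[OF c(2) p(2)], of "-1"]]
    by simp
  moreover have "torus_integral (\<lambda>x. (\<eta> x + ?v x)\<^sup>2) - torus_integral (\<lambda>x. (\<eta> x - ?v x)\<^sup>2) = 4 * torus_integral (\<lambda>x. \<eta> x * ?v x)"
  proof -
    have "torus_integral (\<lambda>x. (\<eta> x + ?v x)\<^sup>2) - torus_integral (\<lambda>x. (\<eta> x - ?v x)\<^sup>2)
        = torus_integral (\<lambda>x. (\<eta> x + ?v x)\<^sup>2 - (\<eta> x - ?v x)\<^sup>2)"
      unfolding torus_integral_eq
      by (intro Bochner_Integration.integral_diff[symmetric] integrable_torus_continuous continuous_intros c)
    also have "\<dots> = torus_integral (\<lambda>x. 4 * (\<eta> x * ?v x))"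
      by (simp add: power2_eq_square algebra_simps)
    finally show ?thesis by (simp add: torus_integral_eq)
  qed
  ultimately have "((\<lambda>n. 4 * (What n * (norm (fourier_coeff \<eta> n))\<^sup>2)) has_sum 4 * torus_integral (\<lambda>x. \<eta> x * ?v x)) UNIV"
    by (simp only: coeff nrm)
  then show ?thesis by (simp add: has_sum_cmult_right_iff)
qed

end

section \<open>Second variation\<close>

text \<open>The Leibniz rule is used for the gauge integral over a box; continuity of the integrands
  lets both kinds of integral be exchanged. Openness of \<open>U\<close> turns the derivative within
  \<open>U\<close> into a full one.\<close>

lemma torus_integral_has_derivative:
  fixes f :: "real \<Rightarrow> real ^ 'd::finite \<Rightarrow> real"
  assumes U: "open U" "convex U" "t \<in> U"
    and cont: "\<And>s. s \<in> U \<Longrightarrow> continuous_on UNIV (f s)"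
    and deriv: "\<And>s x. s \<in> U \<Longrightarrow> ((\<lambda>s. f s x) has_real_derivative f' s x) (at s)"
    and cont': "continuous_on (U \<times> UNIV) (\<lambda>(s, x). f' s x)"
  shows "((\<lambda>s. torus_integral (f s)) has_real_derivative torus_integral (f' t)) (at t)"
proof -
  have henstock: "torus_integral g = integral torus_cell g" "g integrable_on torus_cell"
    if g: "continuous_on UNIV g" for g :: "real ^ 'd \<Rightarrow> real"
  proof -
    have "set_integrable lborel torus_cell g"
      unfolding set_integrable_def torus_cell_def
      by (rule borel_integrable_compact[OF compact_cbox continuous_on_subset[OF g]]) simp
    then show "torus_integral g = integral torus_cell g" "g integrable_on torus_cell"
      by (simp_all add: torus_integral_def set_borel_integral_eq_integral)
  qed
  have "continuous_on UNIV (\<lambda>x :: real ^ 'd. (t, x))" by (intro continuous_intros)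
  then have "continuous_on UNIV (f' t)"
    using continuous_on_compose2[OF cont', of UNIV "\<lambda>x. (t, x)"] U(3) by auto
  note f't = henstock(1)[OF this]
  have "((\<lambda>s. integral torus_cell (f s)) has_real_derivative integral torus_cell (f' t)) (at t within U)"
    unfolding torus_cell_def
  proof (rule leibniz_rule_field_derivative[OF _ _ _ U(3,2)])
    show "((\<lambda>s. f s x) has_real_derivative f' s x) (at s within U)" if "s \<in> U" for s x
      using deriv[OF that] by (rule has_field_derivative_at_within)
    show "f s integrable_on cbox (\<chi> i. - (1/2)) (\<chi> i. 1/2)" if "s \<in> U" for s
      using henstock(2)[OF cont[OF that]] by (simp add: torus_cell_def)
    show "continuous_on (U \<times> cbox (\<chi> i. - (1/2)) (\<chi> i. 1/2)) (\<lambda>(s, x). f' s x)"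
      using cont' by (rule continuous_on_subset) auto
  qed
  then have "((\<lambda>s. integral torus_cell (f s)) has_real_derivative torus_integral (f' t)) (at t)"
    unfolding at_within_open[OF U(3,1)] f't .
  then show ?thesis
    by (rule has_field_derivative_transform_within_open[OF _ U(1,3)]) (simp add: henstock cont)
qed

lemma second_deriv_eqI:
  fixes f :: "real \<Rightarrow> real"
  assumes "open U" "x \<in> U" "\<And>y. y \<in> U \<Longrightarrow> (f has_real_derivative f' y) (at y)"
    and "(f' has_real_derivative D) (at x)"
  shows "(deriv ^^ 2) f x = D"
proof -
  have "(deriv f has_real_derivative D) (at x)"
    by (rule has_field_derivative_transform_within_open[OF assms(4,1,2)]) (metis DERIV_imp_deriv assms(3))
  then show ?thesis by (simp add: numeral_2_eq_2 DERIV_imp_deriv)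
qed

section \<open>Functions in a single mode\<close>

lemma mode_space_iff:
  "\<eta> \<in> mode_space n \<longleftrightarrow> (\<exists>c. \<eta> = (\<lambda>x. Re (c * character n x)))"
proof
  assume "\<eta> \<in> mode_space n"
  then obtain a b where "\<eta> = (\<lambda>x. a * cos (2 * pi * (real_vec n \<bullet> x)) + b * sin (2 * pi * (real_vec n \<bullet> x)))"
    by (auto simp: mode_space_def)
  then show "\<exists>c. \<eta> = (\<lambda>x. Re (c * character n x))"
    \<comment> \<open>One complex amplitude encodes both real coefficients; the sign is that of
      Re((a - i b) e^(i t)) = a cos t + b sin t.\<close>
    by (intro exI[of _ "Complex a (- b)"]) (simp add: character_def)
next
  assume "\<exists>c. \<eta> = (\<lambda>x. Re (c * character n x))"
  then obtain c where "\<eta> = (\<lambda>x. Re (c * character n x))" ..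
  then show "\<eta> \<in> mode_space n"
    unfolding mode_space_def mem_Collect_eq
    by (intro exI[of _ "Re c"] exI[of _ "- Im c"]) (simp add: character_def)
qed

lemma continuous_mode: "continuous_on UNIV (\<lambda>x. Re (c * character n x))"
  by (intro continuous_intros)

lemma periodic_mode: "periodic (\<lambda>x. Re (c * character n x))"
  by (simp add: periodic_def periodicD[OF periodic_character])

text \<open>A real part is half the function plus half its conjugate, and the conjugate has
  frequency \<open>- n\<close>, which differs from \<open>n\<close> as \<open>n\<close> is
  nonzero.\<close>

lemma fourier_coeff_mode:
  assumes "n \<noteq> 0"
  shows "fourier_coeff (\<lambda>x. Re (c * character n x)) n = c / 2"
proof -
  have eq: "complex_of_real (Re z) = (1/2) * z + (1/2) * cnj z" for z
    by (simp add: complex_eq_iff)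
  have "fourier_coeff (\<lambda>x. Re (c * character n x)) n =
      cfourier (\<lambda>x. (c/2) * character n x + (cnj c/2) * character (- n) x) n"
    unfolding fourier_coeff_eq eq by (simp add: character_uminus)
  also have "\<dots> = c / 2 * cfourier (character n) n + cnj c / 2 * cfourier (character (- n)) n"
    by (subst cfourier_add) (auto intro!: continuous_intros simp only: cfourier_scale)
  also have "n \<noteq> - n"
    using assms by (simp add: vec_eq_iff)
  then have "c / 2 * cfourier (character n) n + cnj c / 2 * cfourier (character (- n)) n = c / 2"
    by (simp add: cfourier_character)
  finally show ?thesis .
qed

text \<open>(Re z)^2 = |z|^2 / 2 + Re(z^2) / 2, and the square of the mode oscillates with the
  nonzero frequency \<open>n + n\<close>, so it integrates to 0.\<close>

lemma torus_integral_mode_square: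
  assumes "n \<noteq> 0"
  shows "torus_integral (\<lambda>x. (Re (c * character n x))\<^sup>2) = (norm c)\<^sup>2 / 2"
proof -
  have eq: "(Re z)\<^sup>2 = (norm z)\<^sup>2 / 2 + Re (z * z) / 2" for z
    unfolding cmod_power2 by (simp add: power2_eq_square field_simps)
  have "n + n \<noteq> 0" using assms by (simp add: vec_eq_iff)
  then have 0: "torus_integral (character (n + n)) = 0"
    by (simp only: torus_integral_character if_False)
  have i: "integrable torus_measure (character (n + n))"
    by (intro integrable_torus_continuous continuous_character continuous_on_id)
  have "torus_integral (\<lambda>x. (Re (c * character n x))\<^sup>2) =
      torus_integral (\<lambda>x. (norm c)\<^sup>2 / 2 + Re ((c * c / 2) * character (n + n) x))"
  proof -
    have sq: "(c * c / 2) * character (n + n) x = (c * character n x) * (c * character n x) / 2" for x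
      by (simp only: character_add) simp
    show ?thesis unfolding eq sq by (simp add: norm_mult del: times_complex.sel)
  qed
  also have "\<dots> = (norm c)\<^sup>2 / 2 + Re ((c * c / 2) * torus_integral (character (n + n)))"
    unfolding torus_integral_eq
    using i by (simp add: measure_torus_space del: times_complex.sel)
  finally show ?thesis unfolding 0 by simp
qed

section \<open>The free energy along constant plus perturbation\<close>

context torus_kernel
begin

text \<open>Only the entropy has to be differentiated under the integral, with densities u (ln u -
  1), ln u and 1/u in turn; the interaction is an explicit quadratic polynomial in
  \<open>t\<close>.\<close>

lemma second_variation_free_energy:
  assumes \<rho>: "\<rho>\<^sub>0 > 0" and \<eta>: "continuous_on UNIV \<eta>" "periodic \<eta>"
  shows "second_variation (free_energy \<beta> W) \<rho>\<^sub>0 \<eta> =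
    torus_integral (\<lambda>x. (\<eta> x)\<^sup>2 / \<rho>\<^sub>0) - 2 * \<beta> * torus_integral (\<lambda>x. \<eta> x * torus_conv W \<eta> x)"
proof -
  obtain C where C: "C > 0" "\<And>x. \<bar>\<eta> x\<bar> \<le> C"
    using periodic_continuous_bounded[OF \<eta>] by auto
  \<comment> \<open>For |t| below this radius the perturbation stays under
    \<open>\<rho>\<^sub>0\<close> uniformly in \<open>x\<close>, so the logarithm is evaluated at
    positive densities.\<close>
  define U where "U = ball (0::real) (\<rho>\<^sub>0 / C)"
  have U: "open U" "convex U" "0 \<in> U" using \<rho> C by (auto simp: U_def)
  have pos: "\<rho>\<^sub>0 + t * \<eta> x > 0" if "t \<in> U" for t x
  proof -
    have "\<bar>t * \<eta> x\<bar> \<le> \<bar>t\<bar> * C" using C by (auto simp: abs_mult intro: mult_left_mono)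
    also have "\<dots> < \<rho>\<^sub>0" using that C(1) by (simp add: U_def field_simps)
    finally show ?thesis by linarith
  qed
  let ?v = "torus_conv W \<eta>"
  note v = conv_continuous[OF \<eta>]
  \<comment> \<open>The linear coefficient in \<open>t\<close>; it disappears on the second
    differentiation, while the quadratic coefficient \<open>q\<close> is doubled.\<close>
  define b where "b = \<rho>\<^sub>0 * (torus_integral \<eta> + torus_integral ?v)"
  define q where "q = torus_integral (\<lambda>x. \<eta> x * ?v x)"
  have quad: "torus_integral (\<lambda>x. (\<rho>\<^sub>0 + t * \<eta> x) * torus_conv W (\<lambda>y. \<rho>\<^sub>0 + t * \<eta> y) x) = \<rho>\<^sub>0\<^sup>2 + t * b + t\<^sup>2 * q" for t
  proof -
    have i: "integrable torus_measure \<eta>" "integrable torus_measure ?v" "integrable torus_measure (\<lambda>x. \<eta> x * ?v x)"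
      by (intro integrable_torus_continuous continuous_intros \<eta> v)+
    have "torus_integral (\<lambda>x. (\<rho>\<^sub>0 + t * \<eta> x) * torus_conv W (\<lambda>y. \<rho>\<^sub>0 + t * \<eta> y) x) =
        torus_integral (\<lambda>x. \<rho>\<^sub>0\<^sup>2 + (t * \<rho>\<^sub>0) * \<eta> x + (t * \<rho>\<^sub>0) * ?v x + t\<^sup>2 * (\<eta> x * ?v x))"
      by (simp add: conv_affine[OF \<eta>] power2_eq_square algebra_simps)
    also have "\<dots> = \<rho>\<^sub>0\<^sup>2 + t * b + t\<^sup>2 * q"
      using i by (simp add: torus_integral_eq measure_torus_space b_def q_def) (simp add: algebra_simps)
    finally show ?thesis .
  qed
  have cont_pair: "continuous_on (U \<times> UNIV) (\<lambda>p. \<eta> (snd p))"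
    by (intro continuous_on_compose2[OF \<eta>(1)] continuous_intros) auto
  have ent: "((\<lambda>s. torus_integral (\<lambda>x. (\<rho>\<^sub>0 + s * \<eta> x) * (ln (\<rho>\<^sub>0 + s * \<eta> x) - 1))) has_real_derivative
      torus_integral (\<lambda>x. \<eta> x * ln (\<rho>\<^sub>0 + t * \<eta> x))) (at t)" if "t \<in> U" for t
  proof (rule torus_integral_has_derivative[OF U(1,2) that])
    fix s assume s: "s \<in> U"
    show "continuous_on UNIV (\<lambda>x. (\<rho>\<^sub>0 + s * \<eta> x) * (ln (\<rho>\<^sub>0 + s * \<eta> x) - 1))"
      using pos[OF s] by (intro continuous_intros \<eta>) (auto simp: less_imp_neq[symmetric])
    show "((\<lambda>s. (\<rho>\<^sub>0 + s * \<eta> x) * (ln (\<rho>\<^sub>0 + s * \<eta> x) - 1)) has_real_derivative \<eta> x * ln (\<rho>\<^sub>0 + s * \<eta> x)) (at s)" for x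
    proof -
      have ln: "((\<lambda>u. u * (ln u - 1)) has_real_derivative ln u) (at u)" if "u > 0" for u :: real
        using that by (auto intro!: derivative_eq_intros)
      have "((\<lambda>s. \<rho>\<^sub>0 + s * \<eta> x) has_real_derivative \<eta> x) (at s)"
        by (auto intro!: derivative_eq_intros)
      from DERIV_chain2[OF ln[OF pos[OF s]] this] show ?thesis by (simp add: mult.commute)
    qed
  next
    show "continuous_on (U \<times> UNIV) (\<lambda>(s, x). \<eta> x * ln (\<rho>\<^sub>0 + s * \<eta> x))"
      unfolding case_prod_beta
      using pos by (intro continuous_intros cont_pair) (auto simp: less_imp_neq[symmetric])
  qed
  have ent': "((\<lambda>s. torus_integral (\<lambda>x. \<eta> x * ln (\<rho>\<^sub>0 + s * \<eta> x))) has_real_derivative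
      torus_integral (\<lambda>x. (\<eta> x)\<^sup>2 / (\<rho>\<^sub>0 + 0 * \<eta> x))) (at 0)"
  proof (rule torus_integral_has_derivative[OF U])
    fix s assume s: "s \<in> U"
    show "continuous_on UNIV (\<lambda>x. \<eta> x * ln (\<rho>\<^sub>0 + s * \<eta> x))"
      using pos[OF s] by (intro continuous_intros \<eta>) (auto simp: less_imp_neq[symmetric])
    show "((\<lambda>s. \<eta> x * ln (\<rho>\<^sub>0 + s * \<eta> x)) has_real_derivative (\<eta> x)\<^sup>2 / (\<rho>\<^sub>0 + s * \<eta> x)) (at s)" for x
      using pos[OF s, of x] by (auto intro!: derivative_eq_intros simp: field_simps power2_eq_square)
  next
    show "continuous_on (U \<times> UNIV) (\<lambda>(s, x). (\<eta> x)\<^sup>2 / (\<rho>\<^sub>0 + s * \<eta> x))"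
      unfolding case_prod_beta
      using pos by (intro continuous_intros cont_pair) (auto simp: less_imp_neq[symmetric])
  qed
  have "(deriv ^^ 2) (\<lambda>t. free_energy \<beta> W (\<lambda>x. \<rho>\<^sub>0 + t * \<eta> x)) 0 = torus_integral (\<lambda>x. (\<eta> x)\<^sup>2 / \<rho>\<^sub>0) - \<beta> * (2 * q)"
    unfolding free_energy_def quad
  proof (rule second_deriv_eqI[OF U(1,3)])
    show "((\<lambda>t. torus_integral (\<lambda>x. (\<rho>\<^sub>0 + t * \<eta> x) * (ln (\<rho>\<^sub>0 + t * \<eta> x) - 1)) - \<beta> * (\<rho>\<^sub>0\<^sup>2 + t * b + t\<^sup>2 * q))
        has_real_derivative torus_integral (\<lambda>x. \<eta> x * ln (\<rho>\<^sub>0 + t * \<eta> x)) - \<beta> * (b + 2 * t * q)) (at t)" if "t \<in> U" for t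
      by (rule derivative_eq_intros ent[OF that] refl | simp)+
    show "((\<lambda>t. torus_integral (\<lambda>x. \<eta> x * ln (\<rho>\<^sub>0 + t * \<eta> x)) - \<beta> * (b + 2 * t * q))
        has_real_derivative torus_integral (\<lambda>x. (\<eta> x)\<^sup>2 / \<rho>\<^sub>0) - \<beta> * (2 * q)) (at 0)"
      by (rule derivative_eq_intros ent'[simplified] refl | simp)+
  qed
  then show ?thesis by (simp add: second_variation_def q_def)
qed

lemma second_variation_has_sum:
  assumes \<rho>: "\<rho>\<^sub>0 > 0" and \<eta>: "continuous_on UNIV \<eta>" "periodic \<eta>" and mean: "torus_integral \<eta> = 0"
  shows "((\<lambda>n. (1 / \<rho>\<^sub>0 - 2 * \<beta> * What n) * (norm (fourier_coeff \<eta> n))\<^sup>2)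
    has_sum second_variation (free_energy \<beta> W) \<rho>\<^sub>0 \<eta>) (UNIV - {0})"
proof -
  let ?a = "\<lambda>n. (norm (fourier_coeff \<eta> n))\<^sup>2"
  let ?f = "\<lambda>n. (1 / \<rho>\<^sub>0 - 2 * \<beta> * What n) * ?a n"
  have "((\<lambda>n. 1 / \<rho>\<^sub>0 * ?a n + (- 2 * \<beta>) * (What n * ?a n)) has_sum
      (1 / \<rho>\<^sub>0 * torus_integral (\<lambda>x. (\<eta> x)\<^sup>2) + (- 2 * \<beta>) * torus_integral (\<lambda>x. \<eta> x * torus_conv W \<eta> x))) UNIV"
    by (intro has_sum_add has_sum_cmult_right parseval has_sum_conv \<eta>)
  moreover have "(\<lambda>n. 1 / \<rho>\<^sub>0 * ?a n + (- 2 * \<beta>) * (What n * ?a n)) = ?f"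
    by (simp add: fun_eq_iff algebra_simps)
  moreover have "1 / \<rho>\<^sub>0 * torus_integral (\<lambda>x. (\<eta> x)\<^sup>2) + (- 2 * \<beta>) * torus_integral (\<lambda>x. \<eta> x * torus_conv W \<eta> x) =
      second_variation (free_energy \<beta> W) \<rho>\<^sub>0 \<eta>"
    by (simp add: second_variation_free_energy[OF \<rho> \<eta>] torus_integral_eq)
  ultimately have "(?f has_sum second_variation (free_energy \<beta> W) \<rho>\<^sub>0 \<eta>) UNIV" by simp
  \<comment> \<open>The zeroth coefficient is the mean, so the sum over the whole lattice loses
    nothing when 0 is removed.\<close>
  moreover have "fourier_coeff \<eta> 0 = 0"
    using mean by (simp add: fourier_coeff_eq cfourier_def torus_integral_eq)
  ultimately show ?thesis
    by (subst has_sum_cong_neutral[of UNIV _ ?f ?f]) auto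
qed

text \<open>Characters are eigenfunctions of convolution; the eigenvalue is real and therefore
  passes through the real part.\<close>

lemma conv_mode: "torus_conv W (\<lambda>x. Re (c * character n x)) x = What n * Re (c * character n x)"
proof -
  have i: "integrable torus_measure (\<lambda>z. complex_of_real (W z) * cnj (character n z))"
  proof -
    obtain B where "\<And>x. \<bar>W x\<bar> \<le> B" using kernel_bound by blast
    then show ?thesis
      by (intro integrable_torus_bounded[where B=B] borel_measurable_times
          measurable_compose[OF measurable borel_measurable_of_real] borel_measurable_continuous_onI continuous_intros)
        (auto simp: norm_mult)
  qed
  have "torus_conv W (\<lambda>x. Re (c * character n x)) x = torus_integral (\<lambda>z. W z * Re (c * character n (x - z)))"
    by (rule conv_eq[OF continuous_mode periodic_mode])
  also have "\<dots> = torus_integral (\<lambda>z. Re ((c * character n x) * (of_real (W z) * cnj (character n z))))"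
  proof -
    have "W z * Re (c * character n (x - z)) = Re ((c * character n x) * (of_real (W z) * cnj (character n z)))" for z
    proof -
      have "(c * character n x) * (of_real (W z) * cnj (character n z)) = of_real (W z) * (c * character n (x - z))"
        by (simp add: character_arg_add character_arg_uminus mult_ac flip: add_uminus_conv_diff)
      then show ?thesis by (simp only: times_complex.sel(1) Re_complex_of_real Im_complex_of_real)
    qed
    then show ?thesis by simp
  qed
  also have "\<dots> = Re ((c * character n x) * torus_integral (\<lambda>z. of_real (W z) * cnj (character n z)))"
    unfolding torus_integral_eq using i by (simp del: times_complex.sel)
  finally show ?thesis by (simp add: torus_integral_kernel_character)
qed

lemma second_variation_mode:
  assumes "\<rho>\<^sub>0 > 0" "n \<noteq> 0"
  shows "second_variation (free_energy \<beta> W) \<rho>\<^sub>0 (\<lambda>x. Re (c * character n x)) =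
    (1 / \<rho>\<^sub>0 - 2 * \<beta> * What n) * ((norm c)\<^sup>2 / 2)"
proof -
  have "Re (c * character n x) * (What n * Re (c * character n x)) = What n * (Re (c * character n x))\<^sup>2" for x
    by (simp add: power2_eq_square)
  then show ?thesis
    using torus_integral_mode_square[OF assms(2), of c]
    by (simp only: second_variation_free_energy[OF assms(1) continuous_mode periodic_mode] conv_mode
        torus_integral_eq integral_mult_right_zero integral_divide_zero) (simp add: left_diff_distrib)
qed

text \<open>On the mode space the second variation is one fixed scalar times half the squared
  modulus of the amplitude, so a single nonzero test function decides the sign for all.\<close>

lemma loses_local_minimality_iff:
  assumes "\<beta> > 0" "\<rho>\<^sub>0 > 0" "n \<noteq> 0"
  shows "loses_local_minimality (free_energy \<beta> W) \<rho>\<^sub>0 n \<longleftrightarrow> What n > 1 / (2 * \<beta> * \<rho>\<^sub>0)"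
proof -
  have "What n > 1 / (2 * \<beta> * \<rho>\<^sub>0) \<longleftrightarrow> 1 / \<rho>\<^sub>0 - 2 * \<beta> * What n < 0"
    using assms by (simp add: field_simps)
  moreover have "loses_local_minimality (free_energy \<beta> W) \<rho>\<^sub>0 n \<longleftrightarrow> 1 / \<rho>\<^sub>0 - 2 * \<beta> * What n < 0"
  proof
    assume L: "loses_local_minimality (free_energy \<beta> W) \<rho>\<^sub>0 n"
    let ?\<eta> = "\<lambda>x. Re (1 * character n x)"
    have "?\<eta> 0 \<noteq> 0" by (simp add: character_def)
    then have "?\<eta> \<noteq> (\<lambda>x. 0)" by metis
    moreover have "?\<eta> \<in> mode_space n" unfolding mode_space_iff by blast
    ultimately have "second_variation (free_energy \<beta> W) \<rho>\<^sub>0 ?\<eta> < 0"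
      using L unfolding loses_local_minimality_def by blast
    then show "1 / \<rho>\<^sub>0 - 2 * \<beta> * What n < 0"
      unfolding second_variation_mode[OF assms(2,3)] by simp
  next
    assume neg: "1 / \<rho>\<^sub>0 - 2 * \<beta> * What n < 0"
    show "loses_local_minimality (free_energy \<beta> W) \<rho>\<^sub>0 n"
      unfolding loses_local_minimality_def
    proof (intro ballI impI)
      fix \<eta> assume "\<eta> \<in> mode_space n" "\<eta> \<noteq> (\<lambda>x. 0)"
      then obtain c where "\<eta> = (\<lambda>x. Re (c * character n x))" "c \<noteq> 0"
        unfolding mode_space_iff by fastforce
      then show "second_variation (free_energy \<beta> W) \<rho>\<^sub>0 \<eta> < 0"
        using neg by (simp only: second_variation_mode[OF assms(2,3)]) (simp add: mult_neg_pos)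
    qed
  qed
  ultimately show ?thesis by simp
qed

end

section \<open>Linearized evolution\<close>

context torus_kernel
begin

text \<open>Minus the Fourier multiplier |2 pi n|^2 (G/2) (G + 2 G' rho0 What_n) at rho0, after
  inserting G' = -beta G, so that G^2 = exp(-2 beta rho0) factors out.\<close>

definition growth_rate :: "real \<Rightarrow> real \<Rightarrow> int ^ 'd \<Rightarrow> real" where
  "growth_rate \<beta> \<rho>\<^sub>0 n =
    - ((2 * pi)\<^sup>2 * (norm (real_vec n))\<^sup>2 / 2 * exp (- 2 * \<beta> * \<rho>\<^sub>0) * (1 - 2 * \<beta> * \<rho>\<^sub>0 * What n))"

lemma linearized_rhs_mode:
  assumes G: "G = (\<lambda>s. exp (- \<beta> * s))" and \<eta>: "\<eta> \<in> mode_space n"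
  shows "linearized_rhs G W \<rho>\<^sub>0 \<eta> x = growth_rate \<beta> \<rho>\<^sub>0 n * \<eta> x"
proof -
  obtain c where \<eta>_eq: "\<eta> = (\<lambda>x. Re (c * character n x))"
    using \<eta> unfolding mode_space_iff by blast
  \<comment> \<open>On the mode, \<open>G(W * \<rho>)\<^sup>2 \<rho>\<close> at \<open>\<rho> = \<rho>\<^sub>0 + t \<eta>\<close> is \<open>h (t \<eta>)\<close>; in its Laplacian the
    gradient term is \<open>O(t\<^sup>2)\<close>, so only \<open>h'(0) \<Delta>\<eta>\<close> survives the linearization.\<close>
  define k where "k = 2 * \<beta> * What n"
  define h where "h w = exp (- 2 * \<beta> * \<rho>\<^sub>0 - k * w) * (\<rho>\<^sub>0 + w)" for w
  define h1 where "h1 w = exp (- 2 * \<beta> * \<rho>\<^sub>0 - k * w) * (1 - k * (\<rho>\<^sub>0 + w))" for w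
  define h2 where "h2 w = - k * exp (- 2 * \<beta> * \<rho>\<^sub>0 - k * w) * (2 - k * (\<rho>\<^sub>0 + w))" for w
  define h3 where "h3 w = k\<^sup>2 * exp (- 2 * \<beta> * \<rho>\<^sub>0 - k * w) * (3 - k * (\<rho>\<^sub>0 + w))" for w
  have h: "(h has_real_derivative h1 w) (at w)" for w
    unfolding h_def h1_def by (auto intro!: derivative_eq_intros simp: algebra_simps)
  have h1: "(h1 has_real_derivative h2 w) (at w)" for w
    unfolding h1_def h2_def by (auto intro!: derivative_eq_intros simp: algebra_simps)
  have h2: "(h2 has_real_derivative h3 w) (at w)" for w
    unfolding h2_def h3_def by (auto intro!: derivative_eq_intros simp: algebra_simps power2_eq_square)
  \<comment> \<open>Along the i-th coordinate line through \<open>x\<close> the mode is a sinusoid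
    of angular frequency \<open>a i\<close>; \<open>Re z\<close> is its value at \<open>x\<close>,
    and \<open>Im z\<close> determines its slope there.\<close>
  define a where "a i = 2 * pi * of_int (n $ i)" for i
  define z where "z = c * character n x"
  have line: "\<eta> (x + s *\<^sub>R axis i 1) = Re z * cos (a i * s) - Im z * sin (a i * s)" for i s
  proof -
    have "character n (s *\<^sub>R axis i 1) = cis (a i * s)"
      by (simp add: character_def inner_axis a_def mult_ac)
    then have "\<eta> (x + s *\<^sub>R axis i 1) = Re (z * cis (a i * s))"
      by (simp only: \<eta>_eq z_def character_arg_add mult.assoc)
    then show ?thesis by simp
  qed
  have \<eta>x: "\<eta> x = Re z" by (simp only: \<eta>_eq z_def)
  have flux: "(G (torus_conv W (\<lambda>y. \<rho>\<^sub>0 + t * \<eta> y) y))\<^sup>2 * (\<rho>\<^sub>0 + t * \<eta> y) = h (t * \<eta> y)" for t y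
  proof -
    have conv: "torus_conv W (\<lambda>y. \<rho>\<^sub>0 + t * \<eta> y) y = \<rho>\<^sub>0 + t * (What n * \<eta> y)"
      unfolding \<eta>_eq conv_affine[OF continuous_mode periodic_mode] conv_mode ..
    show ?thesis
      unfolding conv G h_def k_def exp_double[symmetric] by (simp add: algebra_simps)
  qed
  have second: "(deriv ^^ 2) (\<lambda>s. h (t * \<eta> (x + s *\<^sub>R axis i 1))) 0 =
      t\<^sup>2 * h2 (t * Re z) * (a i * Im z)\<^sup>2 - t * h1 (t * Re z) * ((a i)\<^sup>2 * Re z)" for t i
    unfolding line
  proof (rule second_deriv_eqI[OF open_UNIV UNIV_I])
    let ?p = "\<lambda>s. Re z * cos (a i * s) - Im z * sin (a i * s)"
    let ?p1 = "\<lambda>s. - a i * (Re z * sin (a i * s) + Im z * cos (a i * s))"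
    have p: "((\<lambda>s. t * ?p s) has_real_derivative t * ?p1 s) (at s)" for s
      by (auto intro!: derivative_eq_intros simp: algebra_simps)
    have p1: "((\<lambda>s. t * ?p1 s) has_real_derivative - t * ((a i)\<^sup>2 * Re z)) (at 0)"
      by (auto intro!: derivative_eq_intros simp: algebra_simps power2_eq_square)
    show "((\<lambda>s. h (t * ?p s)) has_real_derivative h1 (t * ?p s) * (t * ?p1 s)) (at s)" for s
      by (rule DERIV_chain2[OF h p])
    show "((\<lambda>s. h1 (t * ?p s) * (t * ?p1 s)) has_real_derivative
        t\<^sup>2 * h2 (t * Re z) * (a i * Im z)\<^sup>2 - t * h1 (t * Re z) * ((a i)\<^sup>2 * Re z)) (at 0)"
      using DERIV_mult[OF DERIV_chain2[OF h1 p, of 0] p1]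
      by (simp add: algebra_simps power2_eq_square)
  qed
  \<comment> \<open>\<open>Q\<close> is the squared gradient of the mode at \<open>x\<close>, and
    \<open>A\<close> is |2 pi n|^2, the eigenvalue of minus the Laplacian.\<close>
  define Q where "Q = (\<Sum>i\<in>UNIV. (a i * Im z)\<^sup>2)"
  define A where "A = (\<Sum>i\<in>UNIV. (a i)\<^sup>2)"
  have A: "A = (2 * pi)\<^sup>2 * (norm (real_vec n))\<^sup>2"
    by (simp add: A_def a_def norm_vec_def L2_set_def sum_nonneg power_mult_distrib sum_distrib_left)
  have rhs: "evolution_rhs G W (\<lambda>y. \<rho>\<^sub>0 + t * \<eta> y) x =
      1/2 * (t\<^sup>2 * h2 (t * Re z) * Q - t * h1 (t * Re z) * (A * Re z))" for t
    unfolding evolution_rhs_def laplacian_def flux second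
    by (simp add: sum_subtractf Q_def A_def sum_distrib_left sum_distrib_right)
  have "((\<lambda>t. 1/2 * (t\<^sup>2 * h2 (t * Re z) * Q - t * h1 (t * Re z) * (A * Re z))) has_real_derivative
      - (1/2 * h1 0 * (A * Re z))) (at 0)"
  proof -
    have lin: "((\<lambda>t. t * Re z) has_real_derivative Re z) (at 0)"
      by (auto intro!: derivative_eq_intros)
    \<comment> \<open>The derivative \<open>h3\<close> comes with the factor
      \<open>t\<^sup>2\<close> and vanishes at 0; the surviving term is \<open>h1 0\<close>, from
      the product with \<open>t\<close>.\<close>
    have c1: "((\<lambda>t. h1 (t * Re z)) has_real_derivative h2 (0 * Re z) * Re z) (at 0)"
      and c2: "((\<lambda>t. h2 (t * Re z)) has_real_derivative h3 (0 * Re z) * Re z) (at 0)"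
      by (rule DERIV_chain2[OF h1 lin], rule DERIV_chain2[OF h2 lin])
    show ?thesis
      by (rule derivative_eq_intros c1 c2 refl | simp)+
  qed
  then have "linearized_rhs G W \<rho>\<^sub>0 \<eta> x = - (1/2 * h1 0 * (A * Re z))"
    unfolding linearized_rhs_def rhs by (rule DERIV_imp_deriv)
  then show ?thesis
    by (simp add: growth_rate_def A h1_def k_def \<eta>x algebra_simps)
qed

text \<open>Integrating factor, for each \<open>x\<close> separately: multiplying by the inverse
  exponential gives a function with zero derivative on the half-line.\<close>

lemma linearized_mode_solution_eq:
  assumes G: "G = (\<lambda>s. exp (- \<beta> * s))" and sol: "linearized_mode_solution G W \<rho>\<^sub>0 n \<eta>" and t: "t \<ge> 0"
  shows "\<eta> t = (\<lambda>x. exp (growth_rate \<beta> \<rho>\<^sub>0 n * t) * \<eta> 0 x)"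
proof
  fix x
  let ?l = "growth_rate \<beta> \<rho>\<^sub>0 n"
  have D: "((\<lambda>s. \<eta> s x) has_real_derivative ?l * \<eta> s x) (at s within {0..})" if "s \<ge> 0" for s
    using sol that linearized_rhs_mode[OF G, of "\<eta> s" n \<rho>\<^sub>0 x]
    unfolding linearized_mode_solution_def by metis
  have "((\<lambda>s. exp (- ?l * s) * \<eta> s x) has_real_derivative 0) (at s within {0..})" if "s \<in> {0..}" for s
  proof -
    have "((\<lambda>s. exp (- ?l * s)) has_real_derivative exp (- ?l * s) * - ?l) (at s within {0..})"
      by (auto intro!: derivative_eq_intros)
    from DERIV_mult[OF this D] show ?thesis using that by simp
  qed
  then have "\<exists>C. \<forall>s\<in>{0..}. exp (- ?l * s) * \<eta> s x = C"
    by (rule has_field_derivative_zero_constant[OF convex_real_interval(1)])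
  then obtain C where C: "\<And>s. s \<in> {0..} \<Longrightarrow> exp (- ?l * s) * \<eta> s x = C" by blast
  have "exp (- ?l * t) * \<eta> t x = \<eta> 0 x" using C[of t] C[of 0] t by simp
  then have "exp (?l * t) * \<eta> 0 x = (exp (?l * t) * exp (- ?l * t)) * \<eta> t x"
    by (metis mult.assoc)
  also have "exp (?l * t) * exp (- ?l * t) = 1" by (simp add: mult_exp_exp)
  finally show "\<eta> t x = exp (?l * t) * \<eta> 0 x" by simp
qed

lemma linearly_unstable_iff_growth_rate:
  assumes G: "G = (\<lambda>s. exp (- \<beta> * s))" and n: "n \<noteq> 0"
  shows "linearly_unstable G W \<rho>\<^sub>0 n \<longleftrightarrow> growth_rate \<beta> \<rho>\<^sub>0 n > 0"
proof
  let ?l = "growth_rate \<beta> \<rho>\<^sub>0 n"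
  have coeff: "norm (fourier_coeff (\<lambda>x. exp r * Re (c * character n x)) n) = exp r * (norm c / 2)" for r c
  proof -
    have "(\<lambda>x. exp r * Re (c * character n x)) = (\<lambda>x. Re ((of_real (exp r) * c) * character n x))"
      by (simp add: algebra_simps)
    then show ?thesis by (simp only: fourier_coeff_mode[OF n]) (simp add: norm_mult norm_divide)
  qed
  {
    assume unst: "linearly_unstable G W \<rho>\<^sub>0 n"
    \<comment> \<open>Instability quantifies over all solutions, so an explicit nonzero one must be
      exhibited to extract the sign of the rate.\<close>
    define \<eta> where "\<eta> t x = exp (?l * t) * Re (1 * character n x)" for t x
    have mode: "\<eta> t \<in> mode_space n" for t
      unfolding mode_space_iff by (intro exI[of _ "of_real (exp (?l * t))"]) (simp add: \<eta>_def fun_eq_iff)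
    have "linearized_mode_solution G W \<rho>\<^sub>0 n \<eta>"
      unfolding linearized_mode_solution_def linearized_rhs_mode[OF G mode]
      using mode by (auto simp: \<eta>_def[abs_def] intro!: derivative_eq_intros)
    moreover have "\<eta> 0 0 \<noteq> 0" by (simp add: \<eta>_def character_def)
    then have "\<eta> 0 \<noteq> (\<lambda>x. 0)" by metis
    ultimately have lim: "filterlim (\<lambda>t. norm (fourier_coeff (\<eta> t) n)) at_top at_top"
      using unst by (simp add: linearly_unstable_def)
    have nrm: "norm (fourier_coeff (\<eta> t) n) = exp (?l * t) * (1 / 2)" for t
      using coeff[of "?l * t" 1] by (simp add: \<eta>_def[abs_def])
    have "eventually (\<lambda>t. exp (?l * t) * (1 / 2) > 1) at_top"
      using lim unfolding filterlim_at_top_dense nrm by blast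
    then have "eventually (\<lambda>t. exp (?l * t) * (1 / 2) > 1 \<and> t \<ge> 0) at_top"
      using eventually_ge_at_top by (rule eventually_conj)
    then obtain t where t: "exp (?l * t) * (1 / 2) > 1" "t \<ge> 0"
      using eventually_happens'[OF trivial_limit_at_top_linorder] by blast
    then have "exp 0 < exp (?l * t)" unfolding exp_zero by linarith
    then have "?l * t > 0" by (simp only: exp_less_cancel_iff)
    then show "?l > 0" using t(2) by (simp add: zero_less_mult_iff)
  }
  {
    assume pos: "?l > 0"
    show "linearly_unstable G W \<rho>\<^sub>0 n"
      unfolding linearly_unstable_def
    proof (intro allI impI, elim conjE)
      fix \<eta> assume sol: "linearized_mode_solution G W \<rho>\<^sub>0 n \<eta>" and "\<eta> 0 \<noteq> (\<lambda>x. 0)"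
      moreover have "\<eta> 0 \<in> mode_space n" using sol by (simp add: linearized_mode_solution_def)
      ultimately obtain c where c: "\<eta> 0 = (\<lambda>x. Re (c * character n x))" "c \<noteq> 0"
        unfolding mode_space_iff by fastforce
      have "filterlim (\<lambda>t. norm c / 2 * exp (?l * t)) at_top at_top"
        using pos c(2)
        by (intro filterlim_tendsto_pos_mult_at_top[OF tendsto_const] filterlim_compose[OF exp_at_top]
            filterlim_tendsto_pos_mult_at_top[OF tendsto_const _ filterlim_ident]) auto
      moreover have "eventually (\<lambda>t. norm (fourier_coeff (\<eta> t) n) = norm c / 2 * exp (?l * t)) at_top"
        using eventually_ge_at_top[of 0]
      proof eventually_elim
        case (elim t)
        then show ?case
          using coeff[of "?l * t" c] by (simp only: linearized_mode_solution_eq[OF G sol] c(1)) simp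
      qed
      ultimately show "filterlim (\<lambda>t. norm (fourier_coeff (\<eta> t) n)) at_top at_top"
        by (subst filterlim_cong[OF refl refl])
    qed
  }
qed

lemma growth_rate_pos_iff:
  assumes "n \<noteq> 0"
  shows "growth_rate \<beta> \<rho>\<^sub>0 n > 0 \<longleftrightarrow> 1 - 2 * \<beta> * \<rho>\<^sub>0 * What n < 0"
proof -
  have "real_vec n \<noteq> 0"
    using assms by (simp add: vec_eq_iff)
  then have "(2 * pi)\<^sup>2 * (norm (real_vec n))\<^sup>2 / 2 * exp (- 2 * \<beta> * \<rho>\<^sub>0) > 0" by simp
  then show ?thesis
    unfolding growth_rate_def neg_0_less_iff_less by (meson mult_less_cancel_left_pos mult_pos_neg mult_less_0_iff not_less_iff_gr_or_eq)
qed

end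

theorem mainTheorem8:
  fixes W :: "real ^ 'd \<Rightarrow> real" and \<beta> M \<rho>\<^sub>0 :: real and G :: "real \<Rightarrow> real"
  assumes "interaction_kernel W"
    and "\<beta> > 0" and "M > 0"
    and "G = (\<lambda>s. exp (- \<beta> * s))"
    and "\<rho>\<^sub>0 = M / torus_volume TYPE('d)"
  shows
    "(\<forall>\<eta>. torus_smooth \<eta> \<and> torus_integral \<eta> = 0 \<longrightarrow>
        second_variation (free_energy \<beta> W) \<rho>\<^sub>0 \<eta> =
          torus_integral (\<lambda>x. (\<eta> x)\<^sup>2 / \<rho>\<^sub>0)
            - 2 * \<beta> * torus_integral (\<lambda>x. \<eta> x * torus_conv W \<eta> x) \<and>
        ((\<lambda>n. (1 / \<rho>\<^sub>0 - 2 * \<beta> * Re (fourier_coeff W n)) * (norm (fourier_coeff \<eta> n))\<^sup>2)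
          has_sum second_variation (free_energy \<beta> W) \<rho>\<^sub>0 \<eta>) (UNIV - {0})) \<and>
     (\<forall>n. n \<noteq> 0 \<longrightarrow>
        (loses_local_minimality (free_energy \<beta> W) \<rho>\<^sub>0 n \<longleftrightarrow>
           Re (fourier_coeff W n) > 1 / (2 * \<beta> * \<rho>\<^sub>0)) \<and>
        (Re (fourier_coeff W n) > 1 / (2 * \<beta> * \<rho>\<^sub>0) \<longleftrightarrow> linearly_unstable G W \<rho>\<^sub>0 n) \<and>
        (linearly_unstable G W \<rho>\<^sub>0 n \<longleftrightarrow>
           G \<rho>\<^sub>0 + 2 * deriv G \<rho>\<^sub>0 * \<rho>\<^sub>0 * Re (fourier_coeff W n) < 0))"
proof -
  interpret torus_kernel W by (rule interaction_kernel_torus_kernel) fact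
  have \<rho>: "\<rho>\<^sub>0 > 0" using assms by (simp add: torus_volume_eq_1)
  have smooth: "continuous_on UNIV \<eta>" "periodic \<eta>" if "torus_smooth \<eta>" for \<eta> :: "real ^ 'd \<Rightarrow> real"
    using that C_k.simps(1) unfolding torus_smooth_def by blast+
  have unstable: "linearly_unstable G W \<rho>\<^sub>0 n \<longleftrightarrow> 1 - 2 * \<beta> * \<rho>\<^sub>0 * What n < 0" if "n \<noteq> 0" for n
    by (simp only: linearly_unstable_iff_growth_rate[OF assms(4) that] growth_rate_pos_iff[OF that])
  have threshold: "What n > 1 / (2 * \<beta> * \<rho>\<^sub>0) \<longleftrightarrow> 1 - 2 * \<beta> * \<rho>\<^sub>0 * What n < 0" for n
    using \<rho> assms(2) by (simp add: field_simps)
  have "(G has_real_derivative - \<beta> * G \<rho>\<^sub>0) (at \<rho>\<^sub>0)"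
    unfolding assms(4) by (auto intro!: derivative_eq_intros)
  then have "deriv G \<rho>\<^sub>0 = - \<beta> * G \<rho>\<^sub>0" by (rule DERIV_imp_deriv)
  \<comment> \<open>The exponential form of \<open>G\<close> lets the bracket of the linearized
    equation factor, with \<open>G \<rho>\<^sub>0\<close> positive; every criterion thereby reduces
    to the sign of the same expression.\<close>
  then have "G \<rho>\<^sub>0 + 2 * deriv G \<rho>\<^sub>0 * \<rho>\<^sub>0 * What n = G \<rho>\<^sub>0 * (1 - 2 * \<beta> * \<rho>\<^sub>0 * What n)" for n
    by (simp add: algebra_simps)
  moreover have "G \<rho>\<^sub>0 > 0" by (simp add: assms(4))
  ultimately have sign: "G \<rho>\<^sub>0 + 2 * deriv G \<rho>\<^sub>0 * \<rho>\<^sub>0 * What n < 0 \<longleftrightarrow> 1 - 2 * \<beta> * \<rho>\<^sub>0 * What n < 0" for n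
    by (simp only: mult_less_0_iff) auto
  show ?thesis
    using second_variation_free_energy[OF \<rho> smooth] second_variation_has_sum[OF \<rho> smooth]
      loses_local_minimality_iff[OF assms(2) \<rho>] unstable threshold sign
    by blast
qed

end
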